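(* Let $G_1,\dots,G_m$ be groups with property (ET), and let $G=G_1*\cdots*G_m$ be their free product. Then $\mathrm{Tr}(G)$ is not a Poulsen simplex. The same is true if $G$ is an amalgamated free product of the form $G=G_1*_H G_2$, where $G_1,G_2$ have property (ET).
   Context: Groups are discrete. A trace on a group $G$ is a function $\varphi:G\to\mathbb{C}$ which is positive definite, conjugation invariant, and satisfies $\varphi(e)=1$. $\mathrm{Tr}(G)$ is the compact convex set of traces with pointwise convergence, and $\mathrm{Ch}(G)$ is its set of extreme points (characters), with the subspace topology. A group $G$ has property (ET) if the trivial character $1_G$ (constant function $1$) is an isolated point of $\mathrm{Ch}(G)$. Given a group $H$ and homomorphisms $f_i:H\to G_i$ ($i=1,2$), the amalgamated product $G_1*_H G_2$ is the quotient of the free product $G_1*G_2$ by the normal subgroup generated by all $f_1(h)f_2(h)^{-1}$, $h\in H$. A Poulsen simplex is a simplex with dense set of extreme points; here a single point is not counted as a Poulsen simplex (the Poulsen simplex is infinite, with set of extreme points homeomorphic to an infinite-dimensional separable Banach space). *)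

theory Defs
  imports
    "HOL-Analysis.Analysis"
    "HOL-Algebra.Algebra"
    "HOL-Library.Function_Algebras"
begin

section \<open>Function spaces as real vector spaces\<close>

text \<open>Together with the product topology, which is the library's topology on function types,
  this makes \<^typ>\<open>'a \<Rightarrow> complex\<close> the locally convex space of complex functions with
  pointwise convergence.\<close>

instantiation "fun" :: (type, real_vector) real_vector
begin

definition scaleR_fun :: "real \<Rightarrow> ('a \<Rightarrow> 'b) \<Rightarrow> 'a \<Rightarrow> 'b"
  where "scaleR_fun r f = (\<lambda>x. r *\<^sub>R f x)"

instance
  by standard (simp_all add: scaleR_fun_def fun_eq_iff algebra_simps)

end


section \<open>Simplices\<close>

text \<open>\<open>K\<close> is moved to height 1 so that it is the base of a cone, whatever its position
  relative to the origin.\<close>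

definition simplex_cone :: "'v::real_vector set \<Rightarrow> ('v \<times> real) set"
  where "simplex_cone K = {t *\<^sub>R (x, 1) | t x. t \<ge> 0 \<and> x \<in> K}"

text \<open>Choquet's definition: the vector space spanned by the cone over \<open>K\<close>, ordered by that cone,
  is a lattice. For nonempty convex \<open>K\<close> this space is the set of differences of elements of
  the cone. The ambient space is meant to be a Hausdorff locally convex space.\<close>

definition choquet_simplex :: "'v::{real_vector, topological_space} set \<Rightarrow> bool"
  where "choquet_simplex K \<longleftrightarrow>
    K \<noteq> {} \<and> compact K \<and> convex K \<and>
    lattice \<lparr>carrier = {p - q | p q. p \<in> simplex_cone K \<and> q \<in> simplex_cone K},
             eq = (=), le = (\<lambda>p q. q - p \<in> simplex_cone K)\<rparr>"

definition poulsen_simplex :: "'v::{real_vector, topological_space} set \<Rightarrow> bool"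
  where "poulsen_simplex K \<longleftrightarrow>
    choquet_simplex K \<and> K \<subseteq> closure {x. x extreme_point_of K} \<and> \<not> is_singleton K"


section \<open>Traces and characters of groups\<close>

definition positive_definite :: "('a, 'm) monoid_scheme \<Rightarrow> ('a \<Rightarrow> complex) \<Rightarrow> bool"
  where "positive_definite G \<phi> \<longleftrightarrow>
    (\<forall>(n::nat) (g :: nat \<Rightarrow> 'a) (c :: nat \<Rightarrow> complex). (\<forall>i<n. g i \<in> carrier G) \<longrightarrow>
      (\<Sum>i<n. \<Sum>j<n. c i * cnj (c j) * \<phi> (inv\<^bsub>G\<^esub> (g j) \<otimes>\<^bsub>G\<^esub> g i)) \<in> \<real>\<^sub>\<ge>\<^sub>0)"

definition conjugation_invariant :: "('a, 'm) monoid_scheme \<Rightarrow> ('a \<Rightarrow> complex) \<Rightarrow> bool"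
  where "conjugation_invariant G \<phi> \<longleftrightarrow>
    (\<forall>g\<in>carrier G. \<forall>h\<in>carrier G. \<phi> (h \<otimes>\<^bsub>G\<^esub> g \<otimes>\<^bsub>G\<^esub> inv\<^bsub>G\<^esub> h) = \<phi> g)"

text \<open>A function on the group is represented by its extension by 0 to the whole carrier type.
  These extensions form a closed subspace on which the topology is pointwise convergence on
  the group.\<close>

definition traces :: "('a, 'm) monoid_scheme \<Rightarrow> ('a \<Rightarrow> complex) set"
  where "traces G = {\<phi>. positive_definite G \<phi> \<and> conjugation_invariant G \<phi> \<and>
    \<phi> \<one>\<^bsub>G\<^esub> = 1 \<and> (\<forall>x. x \<notin> carrier G \<longrightarrow> \<phi> x = 0)}"

definition characters :: "('a, 'm) monoid_scheme \<Rightarrow> ('a \<Rightarrow> complex) set"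
  where "characters G = {\<phi>. \<phi> extreme_point_of traces G}"

definition trivial_character :: "('a, 'm) monoid_scheme \<Rightarrow> 'a \<Rightarrow> complex"
  where "trivial_character G = (\<lambda>x. if x \<in> carrier G then 1 else 0)"

definition property_ET :: "('a, 'm) monoid_scheme \<Rightarrow> bool"
  where "property_ET G \<longleftrightarrow> trivial_character G isolated_in characters G"


section \<open>Free products and amalgamated products\<close>

text \<open>The free product is the set of words in the letters \<open>(i, x)\<close>, \<open>x\<close> in the \<open>i\<close>-th group,
  modulo the least congruence which deletes identities and multiplies adjacent letters
  from the same group.\<close>

definition fp_words :: "'i set \<Rightarrow> ('i \<Rightarrow> 'a monoid) \<Rightarrow> ('i \<times> 'a) list set"
  where "fp_words I Gs = lists (SIGMA i:I. carrier (Gs i))"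

inductive_set fp_rel :: "'i set \<Rightarrow> ('i \<Rightarrow> 'a monoid) \<Rightarrow> (('i \<times> 'a) list \<times> ('i \<times> 'a) list) set"
  for I :: "'i set" and Gs :: "'i \<Rightarrow> 'a monoid" where
  fp_refl: "w \<in> fp_words I Gs \<Longrightarrow> (w, w) \<in> fp_rel I Gs"
| fp_sym: "(v, w) \<in> fp_rel I Gs \<Longrightarrow> (w, v) \<in> fp_rel I Gs"
| fp_trans: "(u, v) \<in> fp_rel I Gs \<Longrightarrow> (v, w) \<in> fp_rel I Gs \<Longrightarrow> (u, w) \<in> fp_rel I Gs"
| fp_one: "u \<in> fp_words I Gs \<Longrightarrow> v \<in> fp_words I Gs \<Longrightarrow> i \<in> I \<Longrightarrow>
    (u @ [(i, \<one>\<^bsub>Gs i\<^esub>)] @ v, u @ v) \<in> fp_rel I Gs"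
| fp_mult: "u \<in> fp_words I Gs \<Longrightarrow> v \<in> fp_words I Gs \<Longrightarrow> i \<in> I \<Longrightarrow>
    x \<in> carrier (Gs i) \<Longrightarrow> y \<in> carrier (Gs i) \<Longrightarrow>
    (u @ [(i, x), (i, y)] @ v, u @ [(i, x \<otimes>\<^bsub>Gs i\<^esub> y)] @ v) \<in> fp_rel I Gs"

definition free_product :: "'i set \<Rightarrow> ('i \<Rightarrow> 'a monoid) \<Rightarrow> ('i \<times> 'a) list set monoid"
  where "free_product I Gs =
    \<lparr>carrier = fp_words I Gs // fp_rel I Gs,
     mult = (\<lambda>A B. \<Union>v\<in>A. \<Union>w\<in>B. fp_rel I Gs `` {v @ w}),
     one = fp_rel I Gs `` {[]}\<rparr>"

definition fp_incl :: "'i set \<Rightarrow> ('i \<Rightarrow> 'a monoid) \<Rightarrow> 'i \<Rightarrow> 'a \<Rightarrow> ('i \<times> 'a) list set"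
  where "fp_incl I Gs i x = fp_rel I Gs `` {[(i, x)]}"

definition normal_closure :: "('a, 'm) monoid_scheme \<Rightarrow> 'a set \<Rightarrow> 'a set"
  where "normal_closure G S = \<Inter>{N. N \<lhd> G \<and> S \<subseteq> N}"

text \<open>The two factors may live on different types, so they are first copied into the sum type.\<close>

definition two_factors :: "'a monoid \<Rightarrow> 'b monoid \<Rightarrow> nat \<Rightarrow> ('a + 'b) monoid"
  where "two_factors G1 G2 i = (if i = 1 then image_group Inl G1 else image_group Inr G2)"

definition amalgamated_product ::
    "'h monoid \<Rightarrow> ('h \<Rightarrow> 'a) \<Rightarrow> ('h \<Rightarrow> 'b) \<Rightarrow> 'a monoid \<Rightarrow> 'b monoid \<Rightarrow>
      (nat \<times> ('a + 'b)) list set set monoid"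
  where "amalgamated_product H f1 f2 G1 G2 =
    (let P = free_product {1, 2} (two_factors G1 G2);
         \<iota>1 = (\<lambda>x. fp_incl {1, 2} (two_factors G1 G2) 1 (Inl x));
         \<iota>2 = (\<lambda>y. fp_incl {1, 2} (two_factors G1 G2) 2 (Inr y))
     in P Mod normal_closure P {\<iota>1 (f1 h) \<otimes>\<^bsub>P\<^esub> inv\<^bsub>P\<^esub> (\<iota>2 (f2 h)) | h. h \<in> carrier H})"

end

theory Submission
  imports Defs
begin

text \<open>
  Write \<open>1\<close> for the trivial character. In both cases \<open>G\<close> is generated by finitely many images of
  groups with property (ET). Such a group inherits that \<open>1\<close> has a neighbourhood without other
  characters, and this already excludes a Poulsen simplex: if there is a trace \<open>\<psi> \<noteq> 1\<close>, then the
  traces \<open>(1 - t) 1 + t \<psi>\<close> with small \<open>t > 0\<close> lie in that neighbourhood and differ from \<open>1\<close>, so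
  they are not limits of characters (\<open>not_poulsen_if_trivializes\<close>).

  To see the inheritance, measure how much of a trace \<open>\<phi>\<close> is trivial on a subgroup \<open>A\<close>: say that
  \<open>\<phi>\<close> has trivial weight at least \<open>\<alpha>\<close> on \<open>A\<close> if \<open>\<phi> - \<alpha> 1\<close> is positive definite on \<open>A\<close>. In the
  finite von Neumann algebra generated by \<open>G\<close> in the GNS representation of \<open>\<phi>\<close>, the largest such
  \<open>\<alpha>\<close> is the trace of the projection onto the \<open>A\<close>-invariant vectors. Three facts are combined.

  \<^item> If \<open>A\<close> is the image of a group with (ET), then the weight of \<open>\<phi>\<close> on \<open>A\<close> tends to 1 as
    \<open>\<phi> \<rightarrow> 1\<close> (\<open>ET_image_trivializes\<close>). The bound that is needed is an inequality between
    continuous affine functions of a trace, so it suffices to check it on characters, where it is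
    the hypothesis that all characters but \<open>1\<close> stay away from \<open>1\<close>.

  \<^item> Weights \<open>\<alpha>\<close> on \<open>A\<close> and \<open>\<beta>\<close> on \<open>B\<close> give weight \<open>\<alpha> + \<beta> - 1\<close> on the subgroup generated by
    \<open>A\<close> and \<open>B\<close> (\<open>trivial_weight_generate\<close>). This is the inequality
    \<open>\<tau>(p \<and> q) \<ge> \<tau>(p) + \<tau>(q) - 1\<close> for projections in a finite von Neumann algebra.

  \<^item> A character of weight \<open>1/2\<close> on \<open>G\<close> is \<open>1\<close>, since otherwise it is the midpoint of \<open>1\<close> and
    another trace (\<open>character_with_trivial_weight\<close>).

  The second fact is the heart of the matter. It is proved without completing anything to a Hilbert
  space: the projections are replaced by convex combinations \<open>p\<close>, \<open>q\<close> of group elements that are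
  self-adjoint and almost idempotent in the 2-norm. The difference \<open>d = p - (1 - q)\<close> of two
  projections has odd moments \<open>\<tau>(d ^ (2 k + 1)) = \<tau>(d)\<close> that do not depend on \<open>k\<close>, while
  \<open>\<tau>(d ^ (2 k)) \<ge> \<tau>(d ^ (2 k + 1))\<close> because \<open>1 - d \<ge> 0\<close>. Hence the powers of the average
  \<open>T = (p + q) / 2 = (1 + d) / 2\<close> satisfy \<open>\<tau>(T ^ n) \<ge> \<tau>(d) = \<tau>(p) + \<tau>(q) - 1\<close>. Some power
  \<open>x = T ^ m\<close> is moreover almost invariant under \<open>A\<close> and \<open>B\<close>, so that \<open>f x\<close> is close to
  \<open>(\<Sum>f) x\<close> for every \<open>f\<close> in the group algebra of the generated subgroup, and the weight can be
  read off from \<open>|f x| \<le> |f|\<close>.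
\<close>


section \<open>Star algebras with a tracial positive functional\<close>

text \<open>The group algebra with the real part of a trace is the intended model. It is treated as a real
algebra with a real trace, so that the semi-inner product \<open>tr (star x * y)\<close> is real and symmetric.\<close>

locale tracial_algebra =
  fixes star :: "'r::real_algebra_1 \<Rightarrow> 'r" and tr :: "'r \<Rightarrow> real"
  assumes star_add: "star (x + y) = star x + star y"
    and star_scaleR: "star (c *\<^sub>R x) = c *\<^sub>R star x"
    and star_mult: "star (x * y) = star y * star x"
    and star_star [simp]: "star (star x) = x"
    and tr_add: "tr (x + y) = tr x + tr y"
    and tr_scaleR: "tr (c *\<^sub>R x) = c * tr x"
    and tr_commute: "tr (x * y) = tr (y * x)"
    and tr_star: "tr (star x) = tr x"
    and tr_pos: "0 \<le> tr (star x * x)"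
    and tr_one [simp]: "tr 1 = 1"
begin

lemma star_one [simp]: "star 1 = 1"
  by (metis mult.right_neutral mult.left_neutral star_mult star_star)

lemma star_minus: "star (- x) = - star x"
  using star_scaleR [of "-1" x] by simp

lemma star_diff: "star (x - y) = star x - star y"
  using star_add [of x "- y"] by (simp add: star_minus)

lemma star_power: "star (x ^ n) = star x ^ n"
  by (induction n) (simp_all add: star_mult power_commutes)

lemma tr_minus: "tr (- x) = - tr x"
  using tr_scaleR [of "-1" x] by simp

lemma tr_diff: "tr (x - y) = tr x - tr y"
  using tr_add [of x "- y"] by (simp add: tr_minus)

lemma tr_zero [simp]: "tr 0 = 0"
  using tr_scaleR [of 0 0] by simp

definition sq :: "'r \<Rightarrow> real"
  where "sq x = tr (star x * x)"

text \<open>The 2-norm of the trace, in general only a seminorm.\<close>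

definition nrm :: "'r \<Rightarrow> real"
  where "nrm x = sqrt (sq x)"

lemma sq_nonneg [simp]: "0 \<le> sq x"
  by (simp add: sq_def tr_pos)

lemma nrm_nonneg [simp]: "0 \<le> nrm x"
  by (simp add: nrm_def)

lemma nrm_power2: "(nrm x)\<^sup>2 = sq x"
  by (simp add: nrm_def)

lemma nrm_le_iff: "nrm x \<le> nrm y \<longleftrightarrow> sq x \<le> sq y"
  by (simp add: nrm_def)

lemma sq_one [simp]: "sq 1 = 1"
  by (simp add: sq_def)

lemma inner_commute: "tr (star x * y) = tr (star y * x)"
  using tr_star [of "star x * y"] by (simp add: star_mult)

lemma sq_add: "sq (x + y) = sq x + 2 * tr (star x * y) + sq y"
  using inner_commute [of x y]
  by (simp add: sq_def star_add tr_add ring_distribs)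

lemma sq_scaleR: "sq (c *\<^sub>R x) = c\<^sup>2 * sq x"
  by (simp add: sq_def star_scaleR tr_scaleR power2_eq_square)

lemma sq_minus [simp]: "sq (- x) = sq x"
  by (simp add: sq_def star_minus)

lemma sq_diff: "sq (x - y) = sq x - 2 * tr (star x * y) + sq y"
  using sq_add [of x "- y"] by (simp add: tr_minus)

lemma parallelogram: "sq (x - y) = 2 * sq x + 2 * sq y - sq (x + y)"
  by (simp add: sq_add sq_diff)

lemma sq_star [simp]: "sq (star x) = sq x"
  by (simp add: sq_def tr_commute)

lemma nrm_star [simp]: "nrm (star x) = nrm x"
  by (simp add: nrm_def)

lemma nrm_minus [simp]: "nrm (- x) = nrm x"
  by (simp add: nrm_def)

lemma nrm_minus_commute: "nrm (x - y) = nrm (y - x)"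
  by (metis minus_diff_eq nrm_minus)

lemma nrm_scaleR: "nrm (c *\<^sub>R x) = \<bar>c\<bar> * nrm x"
  by (simp add: nrm_def sq_scaleR real_sqrt_mult)

lemma nrm_zero [simp]: "nrm 0 = 0"
  by (simp add: nrm_def sq_def)

lemma cauchy_schwarz: "\<bar>tr (star x * y)\<bar> \<le> nrm x * nrm y"
proof -
  let ?b = "tr (star x * y)"
  have quad: "0 \<le> t\<^sup>2 * sq x + 2 * t * ?b + sq y" for t
    using sq_nonneg [of "t *\<^sub>R x + y"]
    by (simp add: sq_add sq_scaleR star_scaleR tr_scaleR)
  have "?b\<^sup>2 \<le> sq x * sq y"
  proof (cases "sq x = 0")
    case True
    have "?b = 0"
    proof (rule ccontr)
      assume "?b \<noteq> 0"
      then show False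
        \<comment> \<open>With \<open>sq x = 0\<close> the polynomial is linear, and \<open>t\<close> is chosen to give it the value \<open>- 1\<close>.\<close>
        using quad [of "- (sq y + 1) / (2 * ?b)"] True by (simp add: field_simps)
    qed
    then show ?thesis
      by simp
  next
    case False
    then have "0 < sq x"
      by (simp add: order.not_eq_order_implies_strict)
    then show ?thesis
      using quad [of "- ?b / sq x"] by (simp add: field_simps power2_eq_square)
  qed
  then have "sqrt (?b\<^sup>2) \<le> sqrt (sq x * sq y)"
    by (rule real_sqrt_le_mono)
  then show ?thesis
    by (simp add: nrm_def real_sqrt_mult)
qed

lemma nrm_triangle: "nrm (x + y) \<le> nrm x + nrm y"
proof (rule power2_le_imp_le)
  show "(nrm (x + y))\<^sup>2 \<le> (nrm x + nrm y)\<^sup>2"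
    using cauchy_schwarz [of x y]
    by (simp add: nrm_power2 sq_add power2_sum)
qed simp

lemma nrm_sum_le: "nrm (\<Sum>i\<in>I. x i) \<le> (\<Sum>i\<in>I. nrm (x i))"
proof (induction I rule: infinite_finite_induct)
  case (insert i I)
  then show ?case
    using nrm_triangle [of "x i" "sum x I"] by simp
qed simp_all

lemma tr_le_nrm: "\<bar>tr x\<bar> \<le> nrm x"
  using cauchy_schwarz [of 1 x] by (simp add: nrm_def)

text \<open>Multiplication from either side is controlled in the 2-norm. This replaces a bound on the operator
norm, and holds for group elements and hence for their convex combinations.\<close>

definition contractive :: "'r \<Rightarrow> bool"
  where "contractive z \<longleftrightarrow> (\<forall>x. nrm (z * x) \<le> nrm x \<and> nrm (x * z) \<le> nrm x)"

lemma contractiveD: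
  assumes "contractive z"
  shows "nrm (z * x) \<le> nrm x" and "nrm (x * z) \<le> nrm x"
  using assms by (simp_all add: contractive_def)

lemma contractive_one: "contractive 1"
  by (simp add: contractive_def)

lemma contractive_mult:
  assumes "contractive x" "contractive y"
  shows "contractive (x * y)"
  using assms unfolding contractive_def by (metis mult.assoc order_trans)

lemma contractive_power: "contractive x \<Longrightarrow> contractive (x ^ n)"
  by (induction n) (simp_all add: contractive_one contractive_mult)

lemma convex_contractive: "convex {z. contractive z}"
proof (rule convexI, clarify)
  fix x y u v
  assume x: "contractive x" and y: "contractive y"
    and uv: "0 \<le> (u::real)" "0 \<le> v" "u + v = 1"
  have *: "nrm (u *\<^sub>R a + v *\<^sub>R b) \<le> nrm c" if "nrm a \<le> nrm c" "nrm b \<le> nrm c" for a b c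
  proof -
    have "nrm (u *\<^sub>R a + v *\<^sub>R b) \<le> u * nrm a + v * nrm b"
      using nrm_triangle [of "u *\<^sub>R a" "v *\<^sub>R b"] uv by (simp add: nrm_scaleR)
    also have "\<dots> \<le> nrm c"
      by (rule convex_bound_le) (use that uv in auto)
    finally show ?thesis .
  qed
  show "contractive (u *\<^sub>R x + v *\<^sub>R y)"
    using x y * unfolding contractive_def by (simp add: distrib_left distrib_right)
qed

lemma contractive_sq_le: "contractive z \<Longrightarrow> sq (z * x) \<le> sq x"
  by (simp add: contractive_def flip: nrm_le_iff)

section \<open>Sequences that vanish in the 2-norm\<close>

text \<open>Identities between projections are used for almost idempotent elements. Every error term is a
product of a defect \<open>p * p - p\<close>, which tends to 0 in the 2-norm, with factors that are bounded
uniformly along the sequence; the null sequences are an ideal for such factors.\<close>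

definition null :: "(nat \<Rightarrow> 'r) \<Rightarrow> bool"
  where "null x \<longleftrightarrow> (\<lambda>j. nrm (x j)) \<longlonglongrightarrow> 0"

definition bounded_mult :: "(nat \<Rightarrow> 'r) \<Rightarrow> bool"
  where "bounded_mult z \<longleftrightarrow> (\<exists>K. \<forall>j x. nrm (z j * x) \<le> K * nrm x \<and> nrm (x * z j) \<le> K * nrm x)"

lemma null_add:
  assumes "null x" "null y"
  shows "null (\<lambda>j. x j + y j)"
  unfolding null_def
proof (rule Lim_null_comparison)
  show "\<forall>\<^sub>F j in sequentially. norm (nrm (x j + y j)) \<le> nrm (x j) + nrm (y j)"
    by (simp add: nrm_triangle)
  show "(\<lambda>j. nrm (x j) + nrm (y j)) \<longlonglongrightarrow> 0"
    using tendsto_add [OF assms [unfolded null_def]] by simp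
qed

lemma null_minus: "null x \<Longrightarrow> null (\<lambda>j. - x j)"
  by (simp add: null_def)

lemma null_diff: "null x \<Longrightarrow> null y \<Longrightarrow> null (\<lambda>j. x j - y j)"
  using null_add [OF _ null_minus] by fastforce

lemma null_mult_left:
  assumes "bounded_mult z" "null x"
  shows "null (\<lambda>j. z j * x j)"
proof -
  obtain K where K: "nrm (z j * y) \<le> K * nrm y" for j y
    using assms(1) unfolding bounded_mult_def by blast
  show ?thesis
    unfolding null_def
  proof (rule Lim_null_comparison)
    show "\<forall>\<^sub>F j in sequentially. norm (nrm (z j * x j)) \<le> K * nrm (x j)"
      by (simp add: K)
    show "(\<lambda>j. K * nrm (x j)) \<longlonglongrightarrow> 0"
      using tendsto_mult_left [OF assms(2) [unfolded null_def], of K] by simp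
  qed
qed

lemma null_mult_right:
  assumes "null x" "bounded_mult z"
  shows "null (\<lambda>j. x j * z j)"
proof -
  obtain K where K: "nrm (y * z j) \<le> K * nrm y" for j y
    using assms(2) unfolding bounded_mult_def by blast
  show ?thesis
    unfolding null_def
  proof (rule Lim_null_comparison)
    show "\<forall>\<^sub>F j in sequentially. norm (nrm (x j * z j)) \<le> K * nrm (x j)"
      by (simp add: K)
    show "(\<lambda>j. K * nrm (x j)) \<longlonglongrightarrow> 0"
      using tendsto_mult_left [OF assms(1) [unfolded null_def], of K] by simp
  qed
qed

lemma tr_null:
  assumes "null x"
  shows "(\<lambda>j. tr (x j)) \<longlonglongrightarrow> 0"
proof (rule Lim_null_comparison)
  show "\<forall>\<^sub>F j in sequentially. norm (tr (x j)) \<le> nrm (x j)"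
    by (simp add: tr_le_nrm)
qed (use assms null_def in auto)

lemma bounded_mult_contractive: "(\<And>j. contractive (z j)) \<Longrightarrow> bounded_mult z"
  unfolding bounded_mult_def contractive_def by (intro exI [of _ 1]) simp

lemma bounded_mult_add:
  assumes "bounded_mult y" "bounded_mult z"
  shows "bounded_mult (\<lambda>j. y j + z j)"
proof -
  obtain K L where K: "nrm (y j * x) \<le> K * nrm x" "nrm (x * y j) \<le> K * nrm x"
    and L: "nrm (z j * x) \<le> L * nrm x" "nrm (x * z j) \<le> L * nrm x" for j x
    using assms unfolding bounded_mult_def by metis
  show ?thesis
    unfolding bounded_mult_def
  proof (intro exI [of _ "K + L"] allI conjI)
    fix j x
    show "nrm ((y j + z j) * x) \<le> (K + L) * nrm x"
      using nrm_triangle [of "y j * x" "z j * x"] K(1) [of j x] L(1) [of j x]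
      by (simp add: ring_distribs)
    show "nrm (x * (y j + z j)) \<le> (K + L) * nrm x"
      using nrm_triangle [of "x * y j" "x * z j"] K(2) [of x j] L(2) [of x j]
      by (simp add: ring_distribs)
  qed
qed

lemma bounded_mult_minus: "bounded_mult z \<Longrightarrow> bounded_mult (\<lambda>j. - z j)"
  by (simp add: bounded_mult_def)

lemma bounded_mult_mult:
  assumes "bounded_mult y" "bounded_mult z"
  shows "bounded_mult (\<lambda>j. y j * z j)"
proof -
  obtain K L where K: "nrm (y j * x) \<le> K * nrm x" "nrm (x * y j) \<le> K * nrm x"
    and L: "nrm (z j * x) \<le> L * nrm x" "nrm (x * z j) \<le> L * nrm x" for j x
    using assms unfolding bounded_mult_def by metis
  have K': "nrm (y j * x) \<le> \<bar>K\<bar> * nrm x" for j x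
    by (meson K(1) abs_ge_self mult_right_mono nrm_nonneg order_trans)
  have L': "nrm (x * z j) \<le> \<bar>L\<bar> * nrm x" for j x
    by (meson L(2) abs_ge_self mult_right_mono nrm_nonneg order_trans)
  show ?thesis
    unfolding bounded_mult_def
  proof (intro exI [of _ "\<bar>K\<bar> * \<bar>L\<bar>"] allI conjI)
    fix j x
    have "nrm (y j * (z j * x)) \<le> \<bar>K\<bar> * nrm (z j * x)"
      by (rule K')
    also have "\<dots> \<le> \<bar>K\<bar> * (\<bar>L\<bar> * nrm x)"
      by (intro mult_left_mono order_trans [OF L(1)] mult_right_mono) auto
    finally show "nrm (y j * z j * x) \<le> \<bar>K\<bar> * \<bar>L\<bar> * nrm x"
      by (simp add: mult.assoc)
    have "nrm (x * y j * z j) \<le> \<bar>L\<bar> * nrm (x * y j)"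
      by (rule L')
    also have "\<dots> \<le> \<bar>L\<bar> * (\<bar>K\<bar> * nrm x)"
      by (intro mult_left_mono order_trans [OF K(2)] mult_right_mono) auto
    finally show "nrm (x * (y j * z j)) \<le> \<bar>K\<bar> * \<bar>L\<bar> * nrm x"
      by (simp add: mult.assoc mult.left_commute)
  qed
qed

lemma bounded_mult_one: "bounded_mult (\<lambda>j. 1)"
  by (simp add: bounded_mult_contractive contractive_one)

lemma bounded_mult_power: "bounded_mult z \<Longrightarrow> bounded_mult (\<lambda>j. z j ^ n)"
  by (induction n) (simp_all add: bounded_mult_one bounded_mult_mult)

end

section \<open>Moments of a difference of two projections\<close>

text \<open>Two sequences of self-adjoint elements that are projections up to null sequences. For
projections the errors in the estimates of this section are zero.\<close>

locale almost_projections = tracial_algebra +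
  fixes p q :: "nat \<Rightarrow> 'a"
  assumes star_p: "star (p j) = p j" and star_q: "star (q j) = q j"
    and bounded_p: "bounded_mult p" and bounded_q: "bounded_mult q"
    and null_p: "null (\<lambda>j. p j * p j - p j)" and null_q: "null (\<lambda>j. q j * q j - q j)"
begin

text \<open>The difference of \<open>p\<close> and the complement \<open>1 - q\<close> of \<open>q\<close>. It is symmetric in \<open>p\<close> and \<open>q\<close>, and
\<open>tr d = tr p + tr q - 1\<close>.\<close>

definition d :: "nat \<Rightarrow> 'a"
  where "d j = p j + q j - 1"

lemma star_d: "star (d j) = d j"
  by (simp add: d_def star_add star_diff star_p star_q)

lemma bounded_d: "bounded_mult d"
proof -
  have "bounded_mult (\<lambda>j. p j + q j + - 1)"
    by (intro bounded_mult_add bounded_mult_minus bounded_p bounded_q bounded_mult_one)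
  then show ?thesis
    by (simp add: d_def [abs_def])
qed

lemma bounded_even_power: "bounded_mult (\<lambda>j. (d j * d j) ^ k)"
  by (intro bounded_mult_power bounded_mult_mult bounded_d)

text \<open>The square of the difference of two projections commutes with both of them. For almost projections
the commutator is an explicit combination of the two defects.\<close>

lemma even_power_commutes:
  shows "null (\<lambda>j. (d j * d j) ^ k * p j - p j * (d j * d j) ^ k)"
    and "null (\<lambda>j. (d j * d j) ^ k * q j - q j * (d j * d j) ^ k)"
proof -
  let ?P = "\<lambda>j. p j * p j - p j" and ?Q = "\<lambda>j. q j * q j - q j"
  note bd = bounded_p bounded_q bounded_d bounded_even_power
  have step: "null (\<lambda>j. (d j * d j) ^ k * x j - x j * (d j * d j) ^ k)"
    if x: "null (\<lambda>j. d j * d j * x j - x j * (d j * d j))" for x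
  proof (induction k)
    case 0
    then show ?case
      by (simp add: null_def)
  next
    case (Suc k)
    have "null (\<lambda>j. d j * d j * ((d j * d j) ^ k * x j - x j * (d j * d j) ^ k)
                  + (d j * d j * x j - x j * (d j * d j)) * (d j * d j) ^ k)"
      by (intro null_add null_mult_left null_mult_right bounded_mult_mult bd Suc x)
    then show ?case
      by (simp add: algebra_simps)
  qed
  have "null (\<lambda>j. q j * ?P j - ?P j * q j + ?Q j * p j - p j * ?Q j)"
    by (intro null_add null_diff null_mult_left null_mult_right bd null_p null_q)
  then have "null (\<lambda>j. d j * d j * p j - p j * (d j * d j))"
    by (simp add: d_def algebra_simps)
  then show "null (\<lambda>j. (d j * d j) ^ k * p j - p j * (d j * d j) ^ k)"
    by (rule step)
  have "null (\<lambda>j. p j * ?Q j - ?Q j * p j + ?P j * q j - q j * ?P j)"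
    by (intro null_add null_diff null_mult_left null_mult_right bd null_p null_q)
  then have "null (\<lambda>j. d j * d j * q j - q j * (d j * d j))"
    by (simp add: d_def algebra_simps)
  then show "null (\<lambda>j. (d j * d j) ^ k * q j - q j * (d j * d j) ^ k)"
    by (rule step)
qed

text \<open>For projections \<open>d ^ 3 - d = (p q p - p q) + (q p q - q p)\<close>. The trace of each bracket vanishes
also after multiplication with an even power of \<open>d\<close>, because that power commutes with \<open>p\<close> and
\<open>q\<close> and \<open>p p = p\<close>. This is the argument for the trace of odd powers of a difference of
projections in the theory of the index of a pair of projections.\<close>

lemma tr_odd_power_step: "(\<lambda>j. tr ((d j * d j) ^ Suc k * d j) - tr ((d j * d j) ^ k * d j)) \<longlonglongrightarrow> 0"
proof -
  let ?P = "\<lambda>j. p j * p j - p j" and ?Q = "\<lambda>j. q j * q j - q j"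
  let ?e = "\<lambda>j. (d j * d j) ^ k"
  note bd = bounded_p bounded_q bounded_d bounded_even_power
  let ?n = "\<lambda>j. ?e j * (d j * (?P j + ?Q j) + ?P j * q j + ?Q j * p j - (?P j + ?Q j))"
  let ?m = "\<lambda>j. ?e j * ?P j * q j + ?e j * ?Q j * p j
      - (?e j * p j - p j * ?e j) * p j * q j - (?e j * q j - q j * ?e j) * q j * p j"
  have n: "null ?n"
    by (intro null_add null_diff null_mult_left null_mult_right bd null_p null_q)
  have m: "null ?m"
    by (intro null_add null_diff null_mult_left null_mult_right bd null_p null_q even_power_commutes)
  have eq: "tr ((d j * d j) ^ Suc k * d j) - tr ((d j * d j) ^ k * d j) = tr (?n j) + tr (?m j)" for j
  proof -
    have cube: "d j * d j * d j - d j = (d j * (?P j + ?Q j) + ?P j * q j + ?Q j * p j - (?P j + ?Q j))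
      + (p j * q j * p j - p j * q j + q j * p j * q j - q j * p j)"
      by (simp add: d_def algebra_simps)
    have pq: "tr (?e j * (r * s * r - r * s)) =
        tr (?e j * (r * r - r) * s - (?e j * r - r * ?e j) * r * s)" for r s
      using tr_commute [of "?e j * (r * s)" r]
      by (simp add: algebra_simps tr_diff tr_add)
    have "tr ((d j * d j) ^ Suc k * d j) - tr ((d j * d j) ^ k * d j) =
        tr (?e j * (d j * d j * d j - d j))"
      by (simp only: power_Suc2 tr_diff right_diff_distrib mult.assoc)
    also have "\<dots> = tr (?n j) + tr (?e j * (p j * q j * p j - p j * q j))
        + tr (?e j * (q j * p j * q j - q j * p j))"
      unfolding cube by (simp only: ring_distribs tr_add tr_diff)
    also have "\<dots> = tr (?n j) + tr (?m j)"
      using pq [of "p j" "q j"] pq [of "q j" "p j"] by (simp add: tr_add tr_diff)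
    finally show ?thesis .
  qed
  show ?thesis
    unfolding eq using tendsto_add [OF tr_null [OF n] tr_null [OF m]] by simp
qed

lemma tr_odd_power: "(\<lambda>j. tr (d j ^ Suc (2 * k)) - tr (d j)) \<longlonglongrightarrow> 0"
proof (induction k)
  case (Suc k)
  have odd: "(d j * d j) ^ k * d j = d j ^ Suc (2 * k)" for j k
    using power_commutes [of "d j * d j" k] power_Suc2 [of "d j" "2 * k"]
    by (simp add: power_mult power2_eq_square)
  show ?case
    using tendsto_add [OF tr_odd_power_step [of k, unfolded odd] Suc] by simp
qed simp

text \<open>The element \<open>1 - d = (1 - p) + (1 - q)\<close> is a sum of projections up to a null sequence, so
\<open>tr (d ^ k * (1 - d) * d ^ k)\<close> is nonnegative up to an error that tends to 0.\<close>

lemma tr_even_power: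
  assumes "0 < \<eta>"
  shows "\<forall>\<^sub>F j in sequentially. tr (d j ^ (2 * k)) \<ge> tr (d j ^ Suc (2 * k)) - \<eta>"
proof -
  let ?n = "\<lambda>j. d j ^ k * ((p j * p j - p j) + (q j * q j - q j)) * d j ^ k"
  have "null ?n"
    by (intro null_add null_mult_left null_mult_right bounded_mult_power bounded_d null_p null_q)
  then have "\<forall>\<^sub>F j in sequentially. tr (?n j) < \<eta>"
    using order_tendstoD(2) [OF tr_null] assms by blast
  then show ?thesis
  proof eventually_elim
    case (elim j)
    have "d j ^ (2 * k) - d j ^ Suc (2 * k) = d j ^ k * (1 - d j) * d j ^ k"
      by (simp only: mult_2 power_Suc power_add ring_distribs mult_1_right mult.assoc [symmetric])
        (simp add: power_commutes)
    also have "1 - d j = (1 - p j) * (1 - p j) + (1 - q j) * (1 - q j)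
        - ((p j * p j - p j) + (q j * q j - q j))"
      by (simp add: d_def algebra_simps)
    also have "d j ^ k * \<dots> * d j ^ k = star ((1 - p j) * d j ^ k) * ((1 - p j) * d j ^ k)
        + star ((1 - q j) * d j ^ k) * ((1 - q j) * d j ^ k) - ?n j"
      by (simp add: star_mult star_diff star_p star_q star_power star_d
          distrib_left distrib_right left_diff_distrib right_diff_distrib mult.assoc)
    finally have "tr (d j ^ (2 * k)) - tr (d j ^ Suc (2 * k)) =
        sq ((1 - p j) * d j ^ k) + sq ((1 - q j) * d j ^ k) - tr (?n j)"
      by (simp only: tr_add tr_diff sq_def flip: tr_diff [of "d j ^ (2 * k)"])
    then show ?case
      using elim sq_nonneg [of "(1 - p j) * d j ^ k"] sq_nonneg [of "(1 - q j) * d j ^ k"]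
      by linarith
  qed
qed

lemma tr_power_ge:
  assumes "0 < \<eta>"
  shows "\<forall>\<^sub>F j in sequentially. tr (d j ^ n) \<ge> tr (d j) - \<eta>"
proof -
  have odd: "\<forall>\<^sub>F j in sequentially. tr (d j ^ Suc (2 * k)) \<ge> tr (d j) - \<eta>" if "0 < \<eta>" for k \<eta>
    using order_tendstoD(1) [OF tr_odd_power [of k], of "- \<eta>"] that
    by (auto elim!: eventually_mono)
  show ?thesis
  proof (cases "even n")
    case True
    then obtain k where k: "n = 2 * k"
      by blast
    show ?thesis
      using eventually_conj [OF tr_even_power [of "\<eta> / 2" k] odd [of "\<eta> / 2" k]] assms
      by (auto elim!: eventually_mono simp: k)
  next
    case False
    then obtain k where "n = Suc (2 * k)"
      using oddE by fastforce
    then show ?thesis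
      using odd assms by blast
  qed
qed

text \<open>Since \<open>(p + q) / 2 = (1 + d) / 2\<close>, its powers are averages of powers of \<open>d\<close>. The factor
\<open>d ^ k\<close> lets the induction on \<open>n\<close> run without a binomial expansion.\<close>

lemma tr_average_power_ge:
  assumes "0 < \<eta>"
  shows "\<forall>\<^sub>F j in sequentially. tr (((1/2) *\<^sub>R (p j + q j)) ^ n * d j ^ k) \<ge> tr (p j) + tr (q j) - 1 - \<eta>"
proof (induction n arbitrary: k)
  case 0
  show ?case
    using tr_power_ge [OF assms, of k] by (simp add: d_def tr_add tr_diff)
next
  case (Suc n)
  show ?case
    using Suc [of k] Suc [of "Suc k"]
  proof eventually_elim
    case (elim j)
    let ?T = "(1/2) *\<^sub>R (p j + q j)"
    have "?T = (1/2) *\<^sub>R (1 + d j)"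
      by (simp add: d_def)
    then have "?T * d j ^ k = (1/2) *\<^sub>R (d j ^ k + d j ^ Suc k)"
      by (simp add: ring_distribs)
    then have "?T ^ Suc n * d j ^ k = (1/2) *\<^sub>R (?T ^ n * d j ^ k + ?T ^ n * d j ^ Suc k)"
      by (metis (no_types, lifting) distrib_left mult.assoc mult_scaleR_right power_Suc2)
    then have "tr (?T ^ Suc n * d j ^ k) = (tr (?T ^ n * d j ^ k) + tr (?T ^ n * d j ^ Suc k)) / 2"
      by (simp only: tr_scaleR tr_add)
    with elim show ?case
      by (simp only: field_simps)
  qed
qed

end

section \<open>Almost invariant elements\<close>

lemma slow_step:
  assumes "\<And>k. (0::real) \<le> u k" "u 0 \<le> 1" "0 < N"
  obtains k where "k < N" "u k - u (Suc k) \<le> 1 / real N"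
proof -
  have "\<exists>k<N. u k - u (Suc k) \<le> 1 / real N"
  proof (rule ccontr)
    assume "\<not> ?thesis"
    then have "(\<Sum>k<N. 1 / real N) < (\<Sum>k<N. u k - u (Suc k))"
      using assms(3) by (intro sum_strict_mono) (auto simp: not_le)
    also have "\<dots> = u 0 - u N"
      by (rule sum_lessThan_telescope')
    finally show False
      using assms(1) [of N] assms(2,3) by simp
  qed
  then show thesis
    using that by blast
qed

context tracial_algebra
begin

text \<open>The properties of the convex hull of a subgroup that matter for the construction of invariant
elements.\<close>

definition averaging :: "'r set \<Rightarrow> bool"
  where "averaging S \<longleftrightarrow> S \<noteq> {} \<and> convex S \<and> (\<forall>x\<in>S. \<forall>y\<in>S. x * y \<in> S) \<and>
    (\<forall>x\<in>S. star x \<in> S) \<and> (\<forall>x\<in>S. contractive x)"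

text \<open>A vector of almost minimal length in a convex set is almost fixed by every contraction that
preserves the set: \<open>a\<close> and \<open>z * a\<close> are both almost shortest, and so is their midpoint, so the
parallelogram law forces them together. Here the almost shortest element is \<open>a = star y * y\<close>,
which is positive and, by the choice \<open>z = a\<close>, almost idempotent.\<close>

lemma averaging_almost_projection:
  assumes "averaging S" and \<alpha>: "\<And>y. y \<in> S \<Longrightarrow> \<alpha> \<le> sq y" and "0 < \<epsilon>"
  obtains y where "y \<in> S" "star y * y \<in> S" "\<alpha> \<le> tr (star y * y)"
    "\<And>z. z \<in> S \<Longrightarrow> nrm (z * (star y * y) - star y * y) \<le> \<epsilon>"
proof -
  have S: "convex S" "S \<noteq> {}" "\<And>x y. x \<in> S \<Longrightarrow> y \<in> S \<Longrightarrow> x * y \<in> S"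
    "\<And>x. x \<in> S \<Longrightarrow> star x \<in> S" "\<And>x. x \<in> S \<Longrightarrow> contractive x"
    using assms(1) unfolding averaging_def by auto
  define m where "m = Inf (sq ` S)"
  have m: "m \<le> sq x" if "x \<in> S" for x
    unfolding m_def by (rule cInf_lower) (use that in \<open>auto intro!: bdd_belowI [of _ 0]\<close>)
  have "\<exists>s\<in>sq ` S. s < m + \<epsilon>\<^sup>2 / 4"
    using cInf_lessD [of "sq ` S" "m + \<epsilon>\<^sup>2 / 4"] S(2) \<open>0 < \<epsilon>\<close> by (simp add: m_def)
  then obtain y where y: "y \<in> S" "sq y < m + \<epsilon>\<^sup>2 / 4"
    by blast
  define a where "a = star y * y"
  have a: "a \<in> S" "sq a \<le> sq y"
    using y S contractive_sq_le by (auto simp: a_def)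
  show thesis
  proof
    show "y \<in> S" "star y * y \<in> S" "\<alpha> \<le> tr (star y * y)"
      using y a \<alpha> [of y] by (auto simp: a_def sq_def)
    fix z assume z: "z \<in> S"
    have "(1/2) *\<^sub>R (z * a) + (1/2) *\<^sub>R a \<in> S"
      using convexD [OF S(1), of "z * a" a "1/2" "1/2"] z a S(3) by simp
    then have "m \<le> sq ((1/2) *\<^sub>R (z * a + a))"
      using m by (simp add: scaleR_add_right)
    then have "4 * m \<le> sq (z * a + a)"
      by (simp add: sq_scaleR power2_eq_square)
    moreover have "sq (z * a) \<le> sq a"
      using S z contractive_sq_le by blast
    ultimately have "sq (z * a - a) \<le> \<epsilon>\<^sup>2"
      using parallelogram [of "z * a" a] a(2) y(2) by linarith
    then show "nrm (z * (star y * y) - star y * y) \<le> \<epsilon>"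
      unfolding nrm_def a_def [symmetric] using \<open>0 < \<epsilon>\<close> real_le_lsqrt by auto
  qed
qed

text \<open>The approximate form of \<open>\<tau>(p \<and> q) \<ge> \<tau>(p) + \<tau>(q) - 1\<close>. The projection \<open>p \<and> q\<close> is the limit of
the powers of \<open>T = (p + q) / 2\<close>. The order of the choices matters: a number \<open>N\<close> of powers is fixed
in terms of \<open>\<eta>\<close> alone, then \<open>p\<close> and \<open>q\<close> are chosen so close to projections that the lower bound on
the trace holds for all these powers, and only then an exponent \<open>m < N\<close> is selected at which
\<open>sq (T ^ m)\<close> almost stops decreasing.\<close>

lemma almost_invariant:
  assumes S1: "averaging S1" and S2: "averaging S2"
    and \<alpha>: "\<And>y. y \<in> S1 \<Longrightarrow> \<alpha> \<le> sq y" and \<beta>: "\<And>y. y \<in> S2 \<Longrightarrow> \<beta> \<le> sq y"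
    and "0 < \<eta>"
  obtains x where "contractive x" "\<alpha> + \<beta> - 1 - \<eta> \<le> sq x"
    "\<And>z. z \<in> S1 \<union> S2 \<Longrightarrow> nrm (z * x - x) \<le> \<eta>"
proof -
  have "\<exists>y. y \<in> S1 \<and> star y * y \<in> S1 \<and> \<alpha> \<le> tr (star y * y) \<and>
      (\<forall>z\<in>S1. nrm (z * (star y * y) - star y * y) \<le> 1 / Suc j)" for j
    by (rule averaging_almost_projection [OF S1 \<alpha>, of "1 / Suc j"]) auto
  then obtain y1 where y1: "\<And>j. y1 j \<in> S1" "\<And>j. star (y1 j) * y1 j \<in> S1"
      "\<And>j. \<alpha> \<le> tr (star (y1 j) * y1 j)"
      "\<And>j z. z \<in> S1 \<Longrightarrow> nrm (z * (star (y1 j) * y1 j) - star (y1 j) * y1 j) \<le> 1 / Suc j"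
    by metis
  have "\<exists>y. y \<in> S2 \<and> star y * y \<in> S2 \<and> \<beta> \<le> tr (star y * y) \<and>
      (\<forall>z\<in>S2. nrm (z * (star y * y) - star y * y) \<le> 1 / Suc j)" for j
    by (rule averaging_almost_projection [OF S2 \<beta>, of "1 / Suc j"]) auto
  then obtain y2 where y2: "\<And>j. y2 j \<in> S2" "\<And>j. star (y2 j) * y2 j \<in> S2"
      "\<And>j. \<beta> \<le> tr (star (y2 j) * y2 j)"
      "\<And>j z. z \<in> S2 \<Longrightarrow> nrm (z * (star (y2 j) * y2 j) - star (y2 j) * y2 j) \<le> 1 / Suc j"
    by metis
  define p where "p j = star (y1 j) * y1 j" for j
  define q where "q j = star (y2 j) * y2 j" for j
  have contr: "contractive z" if "z \<in> S1 \<union> S2" for z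
    using that S1 S2 unfolding averaging_def by blast
  have null_defect: "null (\<lambda>j. r j * r j - r j)"
    if "\<And>j. nrm (r j * r j - r j) \<le> 1 / Suc j" for r
    unfolding null_def
  proof (rule Lim_null_comparison)
    show "\<forall>\<^sub>F j in sequentially. norm (nrm (r j * r j - r j)) \<le> 1 / Suc j"
      using that by simp
    show "(\<lambda>j. 1 / Suc j) \<longlonglongrightarrow> 0"
      using LIMSEQ_inverse_real_of_nat by (simp add: inverse_eq_divide)
  qed
  interpret almost_projections star tr p q
  proof
    show "star (p j) = p j" "star (q j) = q j" for j
      by (simp_all add: p_def q_def star_mult)
    show "bounded_mult p" "bounded_mult q"
      using y1(2) y2(2) contr by (auto intro!: bounded_mult_contractive simp: p_def q_def)
    show "null (\<lambda>j. p j * p j - p j)" "null (\<lambda>j. q j * q j - q j)"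
      unfolding p_def q_def by (intro null_defect y1(4) y1(2) y2(4) y2(2))+
  qed
  \<comment> \<open>With this choice \<open>2 / N \<le> (\<eta> / 4)\<^sup>2\<close>, which is used for \<open>fixed\<close> below.\<close>
  define N where "N = nat \<lceil>32 / \<eta>\<^sup>2\<rceil> + 1"
  have N: "0 < N" "32 / \<eta>\<^sup>2 \<le> real N"
    unfolding N_def by linarith+
  define T where "T j = (1/2) *\<^sub>R (p j + q j)" for j
  have "\<forall>\<^sub>F j in sequentially. (\<forall>m\<in>{..<N}. tr (T j ^ (2 * m)) \<ge> tr (p j) + tr (q j) - 1 - \<eta>)"
    using tr_average_power_ge [OF \<open>0 < \<eta>\<close>, of "2 * _" 0]
    by (subst eventually_ball_finite_distrib) (simp_all add: T_def)
  moreover have "\<forall>\<^sub>F j in sequentially. 1 / Suc j \<le> \<eta> / 2"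
    using order_tendstoD(2) [OF LIMSEQ_inverse_real_of_nat, of "\<eta> / 2"] \<open>0 < \<eta>\<close>
    by (auto elim!: eventually_mono simp: inverse_eq_divide)
  ultimately have "\<forall>\<^sub>F j in sequentially. (\<forall>m\<in>{..<N}. tr (T j ^ (2 * m)) \<ge> tr (p j) + tr (q j) - 1 - \<eta>)
      \<and> 1 / Suc j \<le> \<eta> / 2"
    by (rule eventually_conj)
  then obtain j where j: "\<And>m. m < N \<Longrightarrow> tr (T j ^ (2 * m)) \<ge> tr (p j) + tr (q j) - 1 - \<eta>"
      "1 / Suc j \<le> \<eta> / 2"
    by (auto dest!: eventually_happens)
  obtain m where m: "m < N" "sq (T j ^ m) - sq (T j ^ Suc m) \<le> 1 / real N"
    using slow_step [of "\<lambda>m. sq (T j ^ m)" N] N(1) by auto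
  let ?x = "T j ^ m"
  have star_T: "star (T j) = T j"
    by (simp add: T_def star_scaleR star_add star_p star_q)
  have contr_T: "contractive (T j)"
    using convexD [OF convex_contractive, of "p j" "q j" "1/2" "1/2"] contr y1(2) y2(2)
    by (auto simp: T_def p_def q_def scaleR_add_right)
  \<comment> \<open>The operators \<open>p\<close> and \<open>q\<close> satisfy \<open>p * p \<le> p \<le> 1\<close> because \<open>p = star y * y\<close> with contractive \<open>y\<close>.\<close>
  have positive: "sq (star y * y * x) \<le> tr (star x * (star y * y * x))"
    "tr (star x * (star y * y * x)) \<le> sq x" if "contractive y" "contractive (star y)" for x y
  proof -
    have "tr (star x * (star y * y * x)) = sq (y * x)"
      by (simp add: sq_def star_mult mult.assoc)
    then show "sq (star y * y * x) \<le> tr (star x * (star y * y * x))"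
        "tr (star x * (star y * y * x)) \<le> sq x"
      using contractive_sq_le [OF that(1), of x] contractive_sq_le [OF that(2), of "y * x"]
      by (simp_all add: mult.assoc)
  qed
  have c1: "contractive (y1 j)" "contractive (star (y1 j))"
    and c2: "contractive (y2 j)" "contractive (star (y2 j))"
    using y1(1) y2(1) S1 S2 by (auto simp: averaging_def)
  note p_pos = positive [OF c1, of ?x, folded p_def]
  note q_pos = positive [OF c2, of ?x, folded q_def]
  have "sq (T j * ?x) \<le> (sq (p j * ?x) + sq (q j * ?x)) / 2"
    using parallelogram [of "p j * ?x" "q j * ?x"] sq_nonneg [of "p j * ?x - q j * ?x"]
    by (simp add: T_def sq_scaleR power2_eq_square distrib_right)
  \<comment> \<open>If \<open>T\<close> hardly shortens \<open>x\<close>, then neither do \<open>p\<close> and \<open>q\<close>.\<close>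
  then have gap: "sq ?x - (tr (star ?x * (p j * ?x)) + tr (star ?x * (q j * ?x))) / 2 \<le> 1 / real N"
    using m(2) p_pos(1) q_pos(1) by (simp add: field_simps)
  have fixed: "nrm (r * ?x - ?x) \<le> \<eta> / 4"
    if "sq (r * ?x) \<le> tr (star ?x * (r * ?x))"
      "sq ?x - tr (star ?x * (r * ?x)) \<le> 2 / real N" for r
  proof -
    have "sq (r * ?x - ?x) \<le> 2 / real N"
      using sq_diff [of ?x "r * ?x"] sq_minus [of "?x - r * ?x"] that by simp
    also have "\<dots> \<le> (\<eta> / 4)\<^sup>2"
      using N \<open>0 < \<eta>\<close> by (simp add: field_simps power2_eq_square)
    finally show ?thesis
      unfolding nrm_def by (intro real_le_lsqrt) (use \<open>0 < \<eta>\<close> in auto)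
  qed
  have close: "nrm (z * ?x - ?x) \<le> \<eta>"
    if z: "contractive z" and r: "nrm (z * r - r) \<le> 1 / Suc j" "nrm (r * ?x - ?x) \<le> \<eta> / 4" for z r
  proof -
    have eq: "z * ?x - ?x = z * (?x - r * ?x) + ((z * r - r) * ?x + (r * ?x - ?x))"
      by (simp add: algebra_simps)
    have "nrm (z * ?x - ?x) \<le> nrm (z * (?x - r * ?x)) + (nrm ((z * r - r) * ?x) + nrm (r * ?x - ?x))"
      unfolding eq using nrm_triangle [of "z * (?x - r * ?x)" "(z * r - r) * ?x + (r * ?x - ?x)"]
        nrm_triangle [of "(z * r - r) * ?x" "r * ?x - ?x"] by linarith
    moreover have "nrm (z * (?x - r * ?x)) \<le> \<eta> / 4"
      using contractiveD(1) [OF z, of "?x - r * ?x"] r(2) nrm_minus_commute [of ?x "r * ?x"]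
      by linarith
    moreover have "nrm ((z * r - r) * ?x) \<le> 1 / Suc j"
      using contractiveD(2) [OF contractive_power [OF contr_T], of "z * r - r" m] r(1)
      by linarith
    ultimately show ?thesis
      using r(2) j(2) by linarith
  qed
  show thesis
  proof
    show "contractive ?x"
      by (rule contractive_power [OF contr_T])
    have "sq ?x = tr (T j ^ (2 * m))"
      by (simp add: sq_def star_power star_T mult_2 power_add)
    then show "\<alpha> + \<beta> - 1 - \<eta> \<le> sq ?x"
      using j(1) [OF m(1)] y1(3) [of j] y2(3) [of j] by (simp add: p_def q_def)
    fix z assume z: "z \<in> S1 \<union> S2"
    have "sq ?x - tr (star ?x * (p j * ?x)) \<le> 2 / real N"
      "sq ?x - tr (star ?x * (q j * ?x)) \<le> 2 / real N"
      using gap p_pos(2) q_pos(2) by (simp_all add: field_simps)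
    then have "nrm (p j * ?x - ?x) \<le> \<eta> / 4" "nrm (q j * ?x - ?x) \<le> \<eta> / 4"
      using p_pos(1) q_pos(1) fixed by blast+
    then show "nrm (z * ?x - ?x) \<le> \<eta>"
      using z close [OF contr [OF z], of "p j"] close [OF contr [OF z], of "q j"]
        y1(4) [of z j] y2(4) [of z j] by (auto simp: p_def q_def)
  qed
qed

end

section \<open>The algebra of words\<close>

text \<open>Words under concatenation form a monoid, so that the finitely supported functions on words form
a ring, with convolution as multiplication. In this monoid algebra of words in the elements of a
group, two words with the same product in the group are different elements, but a trace does not
distinguish them.\<close>

instantiation list :: (type) monoid_add
begin

definition zero_list :: "'a list"
  where "zero_list = []"

definition plus_list :: "'a list \<Rightarrow> 'a list \<Rightarrow> 'a list"
  where "plus_list = (@)"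

instance
  by standard (simp_all add: zero_list_def plus_list_def)

end

lemma poly_mapping_expand:
  fixes x :: "'k \<Rightarrow>\<^sub>0 'c::comm_monoid_add"
  shows "(\<Sum>k\<in>Poly_Mapping.keys x. Poly_Mapping.single k (poly_mapping.lookup x k)) = x"
  by (rule poly_mapping_eqI) (auto simp: lookup_sum lookup_single when_def in_keys_iff)

lemma poly_mapping_additive_induct [case_names zero single add]:
  fixes x :: "'k \<Rightarrow>\<^sub>0 'c::comm_monoid_add"
  assumes "P 0" "\<And>k c. P (Poly_Mapping.single k c)" "\<And>x y. P x \<Longrightarrow> P y \<Longrightarrow> P (x + y)"
  shows "P x"
proof -
  have "P (\<Sum>k\<in>K. Poly_Mapping.single k (poly_mapping.lookup x k))" if "finite K" for K
    using that by induction (use assms in auto)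
  then show ?thesis
    using poly_mapping_expand [of x] by (metis finite_keys)
qed

text \<open>Matches elements of the algebra with the sums over initial segments of the natural numbers by which
positive definiteness is expressed.\<close>

lemma poly_mapping_enumerate:
  fixes x :: "'k \<Rightarrow>\<^sub>0 'c::comm_monoid_add"
  obtains n w c where "x = (\<Sum>i<(n::nat). Poly_Mapping.single (w i) (c i))"
    "\<And>i. i < n \<Longrightarrow> w i \<in> Poly_Mapping.keys x" "(\<Sum>k\<in>Poly_Mapping.keys x. poly_mapping.lookup x k) = (\<Sum>i<n. c i)"
proof -
  obtain w where w: "bij_betw w {..<card (Poly_Mapping.keys x)} (Poly_Mapping.keys x)"
    using ex_bij_betw_nat_finite [of "Poly_Mapping.keys x"] by (auto simp: atLeast0LessThan)
  show thesis
  proof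
    show "x = (\<Sum>i<card (Poly_Mapping.keys x). Poly_Mapping.single (w i) (poly_mapping.lookup x (w i)))"
      using sum.reindex_bij_betw [OF w, of "\<lambda>k. Poly_Mapping.single k (poly_mapping.lookup x k)"]
      by (simp add: poly_mapping_expand)
    show "w i \<in> Poly_Mapping.keys x" if "i < card (Poly_Mapping.keys x)" for i
      using bij_betwE [OF w] that by auto
    show "(\<Sum>k\<in>Poly_Mapping.keys x. poly_mapping.lookup x k) =
        (\<Sum>i<card (Poly_Mapping.keys x). poly_mapping.lookup x (w i))"
      using sum.reindex_bij_betw [OF w, of "poly_mapping.lookup x"] by simp
  qed
qed

text \<open>Scaling is multiplication with a multiple of the unit, so that the laws of a real algebra follow
from those of a ring once these multiples are known to be central.\<close>

instantiation poly_mapping :: (monoid_add, real_algebra_1) real_algebra_1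
begin

definition scaleR_poly_mapping :: "real \<Rightarrow> ('a \<Rightarrow>\<^sub>0 'b) \<Rightarrow> 'a \<Rightarrow>\<^sub>0 'b"
  where "scaleR_poly_mapping r x = Poly_Mapping.single 0 (of_real r) * x"

instance
proof
  fix r s :: real and x y :: "'a \<Rightarrow>\<^sub>0 'b"
  have central: "x * Poly_Mapping.single 0 (of_real r) = Poly_Mapping.single 0 (of_real r) * x"
    by (induction x rule: poly_mapping_additive_induct)
      (simp_all add: mult_single distrib_left distrib_right of_real_def)
  show "r *\<^sub>R (x + y) = r *\<^sub>R x + r *\<^sub>R y" "(r + s) *\<^sub>R x = r *\<^sub>R x + s *\<^sub>R x"
    by (simp_all add: scaleR_poly_mapping_def distrib_left distrib_right single_add)
  show "r *\<^sub>R s *\<^sub>R x = (r * s) *\<^sub>R x"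
    by (simp add: scaleR_poly_mapping_def mult_single flip: mult.assoc)
  show "1 *\<^sub>R x = x"
    by (simp add: scaleR_poly_mapping_def)
  show "r *\<^sub>R x * y = r *\<^sub>R (x * y)"
    by (simp add: scaleR_poly_mapping_def mult.assoc)
  show "x * r *\<^sub>R y = r *\<^sub>R (x * y)"
    by (simp add: scaleR_poly_mapping_def central flip: mult.assoc)
qed

end

lemma lookup_scaleR: "poly_mapping.lookup (r *\<^sub>R x) k = r *\<^sub>R poly_mapping.lookup x k"
  by (simp add: scaleR_poly_mapping_def Poly_Mapping.map.rep_eq when_def of_real_def
      flip: mult_map_scale_conv_mult)

lemma keys_scaleR: "Poly_Mapping.keys (r *\<^sub>R x) \<subseteq> Poly_Mapping.keys x"
  by (auto simp: in_keys_iff lookup_scaleR)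

text \<open>The extension of a function from single terms to all finite sums, for \<open>F k\<close> additive.\<close>

definition lin_extend :: "('k \<Rightarrow> 'c::zero \<Rightarrow> 'v::comm_monoid_add) \<Rightarrow> ('k \<Rightarrow>\<^sub>0 'c) \<Rightarrow> 'v"
  where "lin_extend F x = (\<Sum>k\<in>Poly_Mapping.keys x. F k (poly_mapping.lookup x k))"

lemma lin_extend_add:
  assumes "\<And>k. F k 0 = 0" "\<And>k a b. F k (a + b) = F k a + F k b"
  shows "lin_extend F (x + y) = lin_extend F x + lin_extend F y"
  unfolding lin_extend_def by (rule setsum_keys_plus_distrib) (use assms in auto)

lemma lin_extend_single: "F k 0 = 0 \<Longrightarrow> lin_extend F (Poly_Mapping.single k c) = F k c"
  by (simp add: lin_extend_def)

lemma lin_extend_zero: "lin_extend F 0 = 0"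
  by (simp add: lin_extend_def)

lemma lin_extend_sum:
  assumes "\<And>k. F k 0 = 0" "\<And>k a b. F k (a + b) = F k a + F k b"
  shows "lin_extend F (sum x I) = (\<Sum>i\<in>I. lin_extend F (x i))"
  by (induction I rule: infinite_finite_induct) (simp_all add: lin_extend_zero lin_extend_add assms)

section \<open>A trace on the algebra of words\<close>

locale group_trace = group G for G :: "('g, 'm) monoid_scheme" (structure) +
  fixes \<phi> :: "'g \<Rightarrow> complex"
  assumes trace: "\<phi> \<in> traces G"
begin

lemma trace_one [simp]: "\<phi> \<one> = 1"
  using trace by (simp add: traces_def)

lemma pos_def:
  assumes "\<And>i. i < (n::nat) \<Longrightarrow> g i \<in> carrier G"
  shows "(\<Sum>i<n. \<Sum>j<n. c i * cnj (c j) * \<phi> (inv (g j) \<otimes> g i)) \<in> \<real>\<^sub>\<ge>\<^sub>0"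
  using trace assms by (simp add: traces_def positive_definite_def)

lemma trace_commute:
  assumes "g \<in> carrier G" "h \<in> carrier G"
  shows "\<phi> (g \<otimes> h) = \<phi> (h \<otimes> g)"
proof -
  have "\<phi> (h \<otimes> (g \<otimes> h) \<otimes> inv h) = \<phi> (g \<otimes> h)"
    using trace assms by (simp add: traces_def conjugation_invariant_def)
  then show ?thesis
    using assms by (simp add: m_assoc)
qed

text \<open>Positive definiteness for the two elements \<open>1\<close> and \<open>g\<close> with coefficients \<open>1\<close> and \<open>z\<close>. The choices
\<open>z = 1\<close> and \<open>z = \<i>\<close> give \<open>\<phi> (inv g) = cnj (\<phi> g)\<close>, and \<open>z = - cnj (\<phi> g)\<close> gives
\<open>|\<phi> g| \<le> 1\<close>.\<close>

lemma pos_def_two: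
  assumes "g \<in> carrier G"
  shows "1 + z * cnj z + z * \<phi> g + cnj z * \<phi> (inv g) \<in> \<real>\<^sub>\<ge>\<^sub>0"
proof -
  have "(\<Sum>i<Suc (Suc 0). \<Sum>j<Suc (Suc 0). (if i = 0 then 1 else z) * cnj (if j = 0 then 1 else z) *
      \<phi> (inv (if j = 0 then \<one> else g) \<otimes> (if i = 0 then \<one> else g))) \<in> \<real>\<^sub>\<ge>\<^sub>0"
    by (rule pos_def) (use assms in auto)
  then show ?thesis
    using assms by (simp add: algebra_simps)
qed

lemma trace_inv:
  assumes "g \<in> carrier G"
  shows "\<phi> (inv g) = cnj (\<phi> g)"
proof (rule complex_eqI)
  show "Im (\<phi> (inv g)) = Im (cnj (\<phi> g))"
    using pos_def_two [OF assms, of 1] by (simp add: complex_nonneg_Reals_iff)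
  show "Re (\<phi> (inv g)) = Re (cnj (\<phi> g))"
    using pos_def_two [OF assms, of \<i>] by (simp add: complex_nonneg_Reals_iff)
qed

lemma cmod_trace_le_one:
  assumes "g \<in> carrier G"
  shows "cmod (\<phi> g) \<le> 1"
proof -
  have "1 + cnj (\<phi> g) * \<phi> g - cnj (\<phi> g) * \<phi> g - \<phi> g * cnj (\<phi> g) \<in> \<real>\<^sub>\<ge>\<^sub>0"
    using pos_def_two [OF assms, of "- cnj (\<phi> g)"] by (simp add: trace_inv assms)
  then have "complex_of_real (1 - (cmod (\<phi> g))\<^sup>2) \<in> \<real>\<^sub>\<ge>\<^sub>0"
    by (simp add: mult.commute of_real_diff [of 1] complex_norm_square del: of_real_power)
  then show ?thesis
    by (simp only: nonneg_Reals_of_real_iff) (simp add: power_le_one_iff)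
qed

text \<open>Letters outside the group count as the identity. Together with the convention in \<open>word_inv\<close> this
makes the identities below hold for all words over the type, so that \<open>star\<close> is an involution of the
whole algebra.\<close>

definition word_value :: "'g list \<Rightarrow> 'g"
  where "word_value w = foldr (\<lambda>g h. (if g \<in> carrier G then g else \<one>) \<otimes> h) w \<one>"

definition word_inv :: "'g list \<Rightarrow> 'g list"
  where "word_inv w = rev (map (\<lambda>g. if g \<in> carrier G then inv g else g) w)"

lemma word_value_closed [simp]: "word_value w \<in> carrier G"
  by (induction w) (auto simp: word_value_def)

lemma word_value_Nil [simp]: "word_value 0 = \<one>" "word_value [] = \<one>"
  by (simp_all add: word_value_def zero_list_def)

lemma word_value_Cons: "word_value (g # w) = (if g \<in> carrier G then g else \<one>) \<otimes> word_value w"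
  by (simp add: word_value_def)

lemma word_value_letter [simp]: "g \<in> carrier G \<Longrightarrow> word_value [g] = g"
  by (simp add: word_value_Cons)

lemma word_value_append [simp]: "word_value (v + w) = word_value v \<otimes> word_value w"
proof (induction v)
  case (Cons g v)
  then show ?case
    using word_value_closed [of v] word_value_closed [of w] by (simp add: word_value_Cons m_assoc plus_list_def)
qed (simp add: plus_list_def)

lemma word_inv_append: "word_inv (v + w) = word_inv w + word_inv v"
  by (simp add: word_inv_def plus_list_def)

lemma word_inv_inv [simp]: "word_inv (word_inv w) = w"
  by (simp add: word_inv_def rev_map o_def map_idI)

lemma word_value_inv [simp]: "word_value (word_inv w) = inv (word_value w)"
proof (induction w)
  case (Cons g w)
  have "word_inv (g # w) = word_inv w + [if g \<in> carrier G then inv g else g]"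
    by (simp add: word_inv_def plus_list_def)
  then show ?case
    using Cons by (simp add: word_value_Cons inv_mult_group)
qed (simp add: word_inv_def)

definition star :: "('g list \<Rightarrow>\<^sub>0 complex) \<Rightarrow> ('g list \<Rightarrow>\<^sub>0 complex)"
  where "star = lin_extend (\<lambda>w c. Poly_Mapping.single (word_inv w) (cnj c))"

text \<open>The linear extension of the trace. The structure of a tracial algebra uses its real part \<open>tr\<close>.\<close>

definition ctr :: "('g list \<Rightarrow>\<^sub>0 complex) \<Rightarrow> complex"
  where "ctr = lin_extend (\<lambda>w c. c * \<phi> (word_value w))"

definition tr :: "('g list \<Rightarrow>\<^sub>0 complex) \<Rightarrow> real"
  where "tr x = Re (ctr x)"

lemma star_single [simp]: "star (Poly_Mapping.single w c) = Poly_Mapping.single (word_inv w) (cnj c)"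
  by (simp add: star_def lin_extend_single)

lemma star_add: "star (x + y) = star x + star y"
  unfolding star_def by (rule lin_extend_add) (simp_all add: single_add)

lemma star_zero: "star 0 = 0"
  by (simp add: star_def lin_extend_zero)

lemma star_sum: "star (sum x I) = (\<Sum>i\<in>I. star (x i))"
  unfolding star_def by (rule lin_extend_sum) (simp_all add: single_add)

lemma ctr_single [simp]: "ctr (Poly_Mapping.single w c) = c * \<phi> (word_value w)"
  by (simp add: ctr_def lin_extend_single)

lemma ctr_add: "ctr (x + y) = ctr x + ctr y"
  unfolding ctr_def by (rule lin_extend_add) (simp_all add: algebra_simps)

lemma ctr_zero: "ctr 0 = 0"
  by (simp add: ctr_def lin_extend_zero)

lemma ctr_sum: "ctr (sum x I) = (\<Sum>i\<in>I. ctr (x i))"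
  unfolding ctr_def by (rule lin_extend_sum) (simp_all add: algebra_simps)

lemma star_mult: "star (x * y) = star y * star x"
proof (induction x rule: poly_mapping_additive_induct)
  case (single v a)
  show ?case
    by (induction y rule: poly_mapping_additive_induct)
      (simp_all add: star_zero star_add mult_single distrib_left distrib_right word_inv_append
        mult.commute)
qed (simp_all add: star_zero star_add distrib_left distrib_right)

lemma star_star: "star (star x) = x"
  by (induction x rule: poly_mapping_additive_induct) (simp_all add: star_zero star_add)

lemma ctr_scale: "ctr (Poly_Mapping.single 0 s * x) = s * ctr x"
  by (induction x rule: poly_mapping_additive_induct)
    (simp_all add: ctr_zero ctr_add mult_single distrib_left)

lemma ctr_commute: "ctr (x * y) = ctr (y * x)"
proof (induction x rule: poly_mapping_additive_induct)
  case (single v a)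
  show ?case
    by (induction y rule: poly_mapping_additive_induct)
      (simp_all add: ctr_zero ctr_add mult_single distrib_left distrib_right trace_commute [of "word_value v"])
qed (simp_all add: ctr_zero ctr_add distrib_left distrib_right)

lemma ctr_star: "ctr (star x) = cnj (ctr x)"
  by (induction x rule: poly_mapping_additive_induct)
    (simp_all add: ctr_zero ctr_add star_zero star_add trace_inv)

lemma ctr_square:
  "ctr (star (\<Sum>i<n. Poly_Mapping.single (w i) (c i)) * (\<Sum>i<n. Poly_Mapping.single (w i) (c i))) =
    (\<Sum>i<n. \<Sum>j<(n::nat). c i * cnj (c j) * \<phi> (inv (word_value (w j)) \<otimes> word_value (w i)))"
  by (subst sum.swap) (simp add: star_sum sum_product mult_single ctr_sum mult.commute)

lemma ctr_pos: "ctr (star x * x) \<in> \<real>\<^sub>\<ge>\<^sub>0"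
proof -
  obtain n w c where "x = (\<Sum>i<(n::nat). Poly_Mapping.single (w i) (c i))"
    by (rule poly_mapping_enumerate [of x]) auto
  then show ?thesis
    by (simp only: ctr_square) (simp add: pos_def)
qed

sublocale tracial_algebra star tr
proof
  fix x y :: "'g list \<Rightarrow>\<^sub>0 complex" and c :: real
  show "star (x + y) = star x + star y"
    by (rule star_add)
  have "star (Poly_Mapping.single 0 (of_real c)) = Poly_Mapping.single 0 (of_real c)"
    by (simp add: word_inv_def zero_list_def)
  moreover have "star x * Poly_Mapping.single 0 (of_real c) = c *\<^sub>R star x"
    using mult_scaleR_right [of "star x" c 1] by (simp add: scaleR_poly_mapping_def)
  ultimately show "star (c *\<^sub>R x) = c *\<^sub>R star x"
    by (simp add: scaleR_poly_mapping_def star_mult)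
  show "star (x * y) = star y * star x" "star (star x) = x"
    by (rule star_mult star_star)+
  show "tr (x + y) = tr x + tr y" "tr (c *\<^sub>R x) = c * tr x"
    by (simp_all add: tr_def ctr_add scaleR_poly_mapping_def ctr_scale)
  show "tr (x * y) = tr (y * x)" "tr (star x) = tr x"
    by (simp_all add: tr_def ctr_commute [of x] ctr_star)
  show "0 \<le> tr (star x * x)"
    using ctr_pos [of x] by (simp add: tr_def complex_nonneg_Reals_iff)
  show "tr 1 = 1"
    by (simp add: tr_def flip: single_one)
qed

text \<open>The trace sees a word only through its product in the group.\<close>

lemma ctr_middle:
  assumes "word_value v = word_value w"
  shows "ctr (x * Poly_Mapping.single v c * y) = ctr (x * Poly_Mapping.single w c * y)"
proof (induction x rule: poly_mapping_additive_induct)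
  case (single u a)
  show ?case
    by (induction y rule: poly_mapping_additive_induct)
      (simp_all add: ctr_zero ctr_add mult_single distrib_left assms)
qed (simp_all add: ctr_zero ctr_add distrib_right)

abbreviation word :: "'g list \<Rightarrow> ('g list \<Rightarrow>\<^sub>0 complex)"
  where "word w \<equiv> Poly_Mapping.single w 1"

lemma sq_word_left: "sq (word w * x) = sq x"
proof -
  have "ctr (star x * word (word_inv w + w) * x) = ctr (star x * word 0 * x)"
    by (rule ctr_middle) simp
  moreover have "star (word w * x) * (word w * x) = star x * word (word_inv w + w) * x"
    by (simp add: star_mult mult.assoc) (simp add: mult_single flip: mult.assoc)
  ultimately show ?thesis
    by (simp add: sq_def tr_def)
qed

lemma contractive_word: "contractive (word w)"
  unfolding contractive_def
proof (intro allI conjI)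
  fix x
  show "nrm (word w * x) \<le> nrm x"
    by (simp add: nrm_def sq_word_left)
  have "nrm (x * word w) = nrm (star (x * word w))"
    by simp
  also have "\<dots> = nrm (star x)"
    by (simp only: star_mult star_single) (simp add: nrm_def sq_word_left)
  finally show "nrm (x * word w) \<le> nrm x"
    by simp
qed

lemma nrm_word_diff:
  assumes "word_value v = word_value w"
  shows "nrm (word v * x - y) = nrm (word w * x - y)"
proof -
  have "tr (star (word v * x) * y) = tr (star (word w * x) * y)"
    using ctr_middle [of "word_inv v" "word_inv w" "star x" 1 y] assms
    by (simp add: tr_def star_mult)
  then show ?thesis
    by (simp add: nrm_def sq_diff sq_word_left)
qed

lemma nrm_scale: "nrm (Poly_Mapping.single 0 s * x) = cmod s * nrm x"
proof -
  have "star (Poly_Mapping.single 0 s * x) * (Poly_Mapping.single 0 s * x)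
      = star x * (Poly_Mapping.single 0 (cnj s) * Poly_Mapping.single 0 s * x)"
    by (simp add: star_mult mult.assoc word_inv_def zero_list_def)
  also have "\<dots> = (cmod s)\<^sup>2 *\<^sub>R (star x * x)"
    using complex_norm_square [of s]
    by (simp add: mult_single mult.commute [of "cnj s"] flip: mult_scaleR_right)
      (simp add: scaleR_poly_mapping_def)
  finally show ?thesis
    by (simp add: nrm_def sq_def tr_scaleR real_sqrt_mult)
qed

end

section \<open>Trivial weight on generated subgroups\<close>

text \<open>For a trace \<open>\<phi>\<close> and a subgroup \<open>A\<close> this says that \<open>\<phi> - \<alpha>\<close> is positive definite on \<open>A\<close>,
since the constant function 1 has the quadratic form \<open>|\<Sum>c|\<^sup>2\<close>.\<close>

definition trivial_weight :: "('a, 'm) monoid_scheme \<Rightarrow> 'a set \<Rightarrow> real \<Rightarrow> ('a \<Rightarrow> complex) \<Rightarrow> bool"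
  where "trivial_weight G A \<alpha> \<phi> \<longleftrightarrow>
    (\<forall>(n::nat) (g :: nat \<Rightarrow> 'a) (c :: nat \<Rightarrow> complex). (\<forall>i<n. g i \<in> A) \<longrightarrow>
      \<alpha> * (cmod (\<Sum>i<n. c i))\<^sup>2 \<le>
        Re (\<Sum>i<n. \<Sum>j<n. c i * cnj (c j) * \<phi> (inv\<^bsub>G\<^esub> (g j) \<otimes>\<^bsub>G\<^esub> g i)))"

context group_trace
begin

definition averages :: "'g set \<Rightarrow> ('g list \<Rightarrow>\<^sub>0 complex) set"
  where "averages A = convex hull {word w | w. word_value w \<in> A}"

lemma word_in_averages: "word_value w \<in> A \<Longrightarrow> word w \<in> averages A"
  unfolding averages_def by (rule hull_inc) auto

lemma averages_induct [consumes 1, case_names word convex]: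
  assumes "x \<in> averages A" "\<And>w. word_value w \<in> A \<Longrightarrow> P (word w)"
    "\<And>x y u v. P x \<Longrightarrow> P y \<Longrightarrow> 0 \<le> u \<Longrightarrow> 0 \<le> v \<Longrightarrow> u + v = 1 \<Longrightarrow> P (u *\<^sub>R x + v *\<^sub>R y)"
  shows "P x"
proof -
  have "averages A \<subseteq> {x. P x}"
    unfolding averages_def by (rule hull_minimal) (use assms in \<open>auto simp: convex_def\<close>)
  then show ?thesis
    using assms(1) by blast
qed

lemma averages_convexD:
  "x \<in> averages A \<Longrightarrow> y \<in> averages A \<Longrightarrow> 0 \<le> u \<Longrightarrow> 0 \<le> v \<Longrightarrow> u + v = 1 \<Longrightarrow>
    u *\<^sub>R x + v *\<^sub>R y \<in> averages A"
  unfolding averages_def using convex_convex_hull by (rule convexD)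

lemma averages_averaging:
  assumes "subgroup A G"
  shows "averaging (averages A)"
proof -
  interpret A: subgroup A G
    by (rule assms)
  have mult: "x * y \<in> averages A" if "x \<in> averages A" "y \<in> averages A" for x y
    using that(1)
  proof (induction rule: averages_induct)
    case (word v)
    show ?case
      using that(2)
    proof (induction rule: averages_induct)
      case (word w)
      then show ?case
        using \<open>word_value v \<in> A\<close> by (auto simp: mult_single intro!: word_in_averages)
    qed (simp add: distrib_left averages_convexD)
  qed (simp add: distrib_right averages_convexD)
  have star: "star x \<in> averages A" if "x \<in> averages A" for x
    using that
    by (induction rule: averages_induct)
      (simp_all add: word_in_averages star_add star_scaleR averages_convexD)
  have contr: "contractive x" if "x \<in> averages A" for x
    using that
    by (induction rule: averages_induct)
      (use convexD [OF convex_contractive] in \<open>auto simp: contractive_word\<close>)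
  have "word 0 \<in> averages A"
    by (rule word_in_averages) simp
  then have "averages A \<noteq> {}"
    by blast
  moreover have "convex (averages A)"
    by (simp add: averages_def convex_convex_hull)
  ultimately show ?thesis
    using mult star contr unfolding averaging_def by blast
qed

text \<open>The augmentation, that is the sum of the coefficients.\<close>

definition aug :: "('g list \<Rightarrow>\<^sub>0 complex) \<Rightarrow> complex"
  where "aug = lin_extend (\<lambda>w c. c)"

lemma aug_single [simp]: "aug (Poly_Mapping.single w c) = c"
  by (simp add: aug_def lin_extend_single)

lemma aug_add: "aug (x + y) = aug x + aug y"
  unfolding aug_def by (rule lin_extend_add) simp_all

lemma aug_scaleR: "aug (r *\<^sub>R x) = r *\<^sub>R aug x"
proof (induction x rule: poly_mapping_additive_induct)
  case zero
  then show ?case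
    by (simp add: aug_def lin_extend_zero)
next
  case (single k c)
  then show ?case
    by (simp add: scaleR_poly_mapping_def mult_single scaleR_conv_of_real)
next
  case (add x y)
  then show ?case
    by (simp add: scaleR_add_right aug_add)
qed

text \<open>An average has augmentation 1, so the weight bounds its 2-norm from below. This is how the weight
enters the construction of almost invariant elements.\<close>

lemma trivial_weight_averages:
  assumes "trivial_weight G A \<alpha> \<phi>" "x \<in> averages A"
  shows "\<alpha> \<le> sq x"
proof -
  have "aug x = 1 \<and> (\<forall>w\<in>Poly_Mapping.keys x. word_value w \<in> A)"
    using assms(2)
  proof (induction rule: averages_induct)
    case (convex x y u v)
    have "aug (u *\<^sub>R x + v *\<^sub>R y) = u *\<^sub>R 1 + v *\<^sub>R 1"
      using convex by (simp add: aug_add aug_scaleR)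
    also have "\<dots> = (u + v) *\<^sub>R 1"
      by (simp only: scaleR_left.add)
    also have "\<dots> = 1"
      using convex by simp
    finally have "aug (u *\<^sub>R x + v *\<^sub>R y) = 1" .
    moreover have "Poly_Mapping.keys (u *\<^sub>R x + v *\<^sub>R y) \<subseteq> Poly_Mapping.keys x \<union> Poly_Mapping.keys y"
      using keys_add [of "u *\<^sub>R x" "v *\<^sub>R y"] keys_scaleR [of u x] keys_scaleR [of v y] by blast
    ultimately show ?case
      using convex by auto
  qed simp
  moreover obtain n w c where x: "x = (\<Sum>i<(n::nat). Poly_Mapping.single (w i) (c i))"
    "\<And>i. i < n \<Longrightarrow> w i \<in> Poly_Mapping.keys x" "(\<Sum>k\<in>Poly_Mapping.keys x. poly_mapping.lookup x k) = (\<Sum>i<n. c i)"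
    by (rule poly_mapping_enumerate [of x]) (rule that)
  ultimately have "(\<Sum>i<n. c i) = 1" "\<forall>i<n. word_value (w i) \<in> A"
    by (auto simp: aug_def lin_extend_def)
  moreover have "sq x = Re (\<Sum>i<n. \<Sum>j<n. c i * cnj (c j) * \<phi> (inv (word_value (w j)) \<otimes> word_value (w i)))"
    unfolding sq_def tr_def x(1) by (simp only: ctr_square)
  ultimately show ?thesis
    using assms(1)[unfolded trivial_weight_def, rule_format, of n "\<lambda>i. word_value (w i)" c] by simp
qed

text \<open>Asymptotic invariance passes to products by \<open>g h x - x = g (h x - x) + (g x - x)\<close>.\<close>

lemma almost_invariant_generate:
  assumes "\<And>w. word_value w \<in> A \<Longrightarrow> null (\<lambda>k. word w * x k - x k)"
    and "A \<subseteq> carrier G"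
    and A: "\<And>g. g \<in> A \<Longrightarrow> inv g \<in> A" and g: "g \<in> generate G A" and "word_value w = g"
  shows "null (\<lambda>k. word w * x k - x k)"
  using g \<open>word_value w = g\<close>
proof (induction arbitrary: w)
  case one
  then have "nrm (word w * x k - x k) = 0" for k
    using nrm_word_diff [of w 0 "x k" "x k"] by simp
  then show ?case
    by (simp add: null_def)
next
  case (incl h)
  then show ?case
    using assms(1) by simp
next
  case (inv h)
  then show ?case
    using assms(1) A by simp
next
  case (eng g h)
  have sub: "generate G A \<subseteq> carrier G"
    using generate_in_carrier [OF assms(2)] by blast
  have carr: "g \<in> carrier G" "h \<in> carrier G"
    using eng(1,2) sub by auto
  have g: "null (\<lambda>k. word [g] * x k - x k)" and h: "null (\<lambda>k. word [h] * x k - x k)"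
    using eng carr by auto
  have "null (\<lambda>k. word [g] * (word [h] * x k - x k) + (word [g] * x k - x k))"
    by (intro null_add null_mult_left g h bounded_mult_contractive contractive_word)
  moreover have "word [g] * (word [h] * x k - x k) + (word [g] * x k - x k)
      = word ([g] + [h]) * x k - x k" for k
    by (simp add: right_diff_distrib mult_single flip: mult.assoc)
  moreover have "word_value ([g] + [h]) = word_value w"
    using eng carr by simp
  ultimately show ?case
    by (simp add: null_def nrm_word_diff [of "[g] + [h]" w])
qed

text \<open>Let \<open>x\<close> be almost invariant under \<open>A\<close> and \<open>B\<close> with \<open>sq x\<close> almost \<open>\<alpha> + \<beta> - 1\<close>. For \<open>f\<close> supported on the
generated subgroup and with coefficient sum \<open>s\<close>, the product \<open>f * x\<close> is close to \<open>s\<close> times \<open>x\<close>, so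
\<open>|s| * nrm x\<close> is at most \<open>nrm (f * x) \<le> nrm f\<close> up to a small error. In the limit this is the
claimed inequality between \<open>|s|\<^sup>2\<close> and the quadratic form of \<open>\<phi>\<close>.\<close>

theorem trivial_weight_generate:
  assumes A: "subgroup A G" and B: "subgroup B G"
    and \<alpha>: "trivial_weight G A \<alpha> \<phi>" and \<beta>: "trivial_weight G B \<beta> \<phi>"
  shows "trivial_weight G (generate G (A \<union> B)) (\<alpha> + \<beta> - 1) \<phi>"
  unfolding trivial_weight_def
proof (intro allI impI)
  fix n :: nat and g :: "nat \<Rightarrow> 'g" and c :: "nat \<Rightarrow> complex"
  assume g: "\<forall>i<n. g i \<in> generate G (A \<union> B)"
  have AB: "A \<union> B \<subseteq> carrier G" "\<And>g. g \<in> A \<union> B \<Longrightarrow> inv g \<in> A \<union> B"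
    using subgroup.subset [OF A] subgroup.subset [OF B] subgroup.m_inv_closed [OF A]
      subgroup.m_inv_closed [OF B] by auto
  then have g_carrier: "g i \<in> carrier G" if "i < n" for i
    using g that generate_in_carrier by blast
  define f where "f = (\<Sum>i<n. Poly_Mapping.single [g i] (c i))"
  define s where "s = (\<Sum>i<n. c i)"
  define \<eta> where "\<eta> k = 1 / real (Suc k)" for k
  have \<eta>: "0 < \<eta> k" for k
    by (simp add: \<eta>_def)
  have \<eta>_lim: "\<eta> \<longlonglongrightarrow> 0"
    unfolding \<eta>_def using LIMSEQ_inverse_real_of_nat by (simp add: inverse_eq_divide)
  have "\<exists>x. contractive x \<and> \<alpha> + \<beta> - 1 - \<eta> k \<le> sq x \<and>
      (\<forall>z\<in>averages A \<union> averages B. nrm (z * x - x) \<le> \<eta> k)" for k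
    by (rule almost_invariant [OF averages_averaging [OF A] averages_averaging [OF B]
          trivial_weight_averages [OF \<alpha>] trivial_weight_averages [OF \<beta>] \<eta>, of k]) auto
  then obtain x where x: "\<And>k. contractive (x k)" "\<And>k. \<alpha> + \<beta> - 1 - \<eta> k \<le> sq (x k)"
      "\<And>k z. z \<in> averages A \<union> averages B \<Longrightarrow> nrm (z * x k - x k) \<le> \<eta> k"
    by metis
  have "null (\<lambda>k. word w * x k - x k)" if "word_value w \<in> A \<union> B" for w
    unfolding null_def
  proof (rule Lim_null_comparison)
    have "word w \<in> averages A \<union> averages B"
      using that word_in_averages by auto
    then show "\<forall>\<^sub>F k in sequentially. norm (nrm (word w * x k - x k)) \<le> \<eta> k"
      using x(3) by simp
  qed (rule \<eta>_lim)
  then have null: "null (\<lambda>k. word [g i] * x k - x k)" if "i < n" for i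
    using almost_invariant_generate [of "A \<union> B" x "g i" "[g i]"] AB g g_carrier that by simp
  define e where "e k = (\<Sum>i<n. cmod (c i) * nrm (word [g i] * x k - x k))" for k
  have e_lim: "e \<longlonglongrightarrow> 0"
    unfolding e_def
    by (rule tendsto_null_sum) (use null in \<open>auto simp: null_def intro!: tendsto_mult_right_zero\<close>)
  have bound: "(cmod s)\<^sup>2 * (\<alpha> + \<beta> - 1 - \<eta> k) \<le> (nrm f + e k)\<^sup>2" for k
  proof -
    let ?s = "Poly_Mapping.single 0 s"
    have eq: "f * x k - ?s * x k =
        (\<Sum>i<n. Poly_Mapping.single 0 (c i) * (word [g i] * x k - x k))"
    proof -
      have s: "?s = (\<Sum>i<n. Poly_Mapping.single 0 (c i))"
        unfolding s_def by (induction n) (simp_all add: single_add)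
      show ?thesis
        unfolding s f_def
        by (simp add: right_diff_distrib sum_subtractf sum_distrib_right mult_single flip: mult.assoc)
    qed
    have "nrm (f * x k - ?s * x k) \<le> e k"
      unfolding eq e_def by (rule order_trans [OF nrm_sum_le]) (simp add: nrm_scale)
    moreover have "nrm (?s * x k) \<le> nrm (f * x k) + nrm (f * x k - ?s * x k)"
      using nrm_triangle [of "f * x k" "?s * x k - f * x k"]
      by (simp add: nrm_minus_commute [of "?s * x k"])
    moreover have "nrm (f * x k) \<le> nrm f"
      by (rule contractiveD(2) [OF x(1)])
    ultimately have "cmod s * nrm (x k) \<le> nrm f + e k"
      by (simp add: nrm_scale)
    then have "(cmod s * nrm (x k))\<^sup>2 \<le> (nrm f + e k)\<^sup>2"
      by (rule power_mono) simp
    moreover have "(cmod s)\<^sup>2 * (\<alpha> + \<beta> - 1 - \<eta> k) \<le> (cmod s)\<^sup>2 * sq (x k)"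
      by (intro mult_left_mono x(2)) simp
    ultimately show ?thesis
      by (simp add: power_mult_distrib nrm_power2)
  qed
  have "(\<lambda>k. (cmod s)\<^sup>2 * (\<alpha> + \<beta> - 1 - \<eta> k)) \<longlonglongrightarrow> (cmod s)\<^sup>2 * (\<alpha> + \<beta> - 1 - 0)"
    by (intro tendsto_intros \<eta>_lim)
  moreover have "(\<lambda>k. (nrm f + e k)\<^sup>2) \<longlonglongrightarrow> (nrm f + 0)\<^sup>2"
    by (intro tendsto_intros e_lim)
  ultimately have "(cmod s)\<^sup>2 * (\<alpha> + \<beta> - 1 - 0) \<le> (nrm f + 0)\<^sup>2"
    by (rule LIMSEQ_le) (use bound in blast)
  then have "(\<alpha> + \<beta> - 1) * (cmod s)\<^sup>2 \<le> sq f"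
    by (simp add: nrm_power2 mult.commute)
  also have "sq f = Re (\<Sum>i<n. \<Sum>j<n. c i * cnj (c j) * \<phi> (inv (g j) \<otimes> g i))"
    unfolding sq_def tr_def f_def using g_carrier by (simp only: ctr_square) simp
  finally show "(\<alpha> + \<beta> - 1) * (cmod (\<Sum>i<n. c i))\<^sup>2 \<le>
      Re (\<Sum>i<n. \<Sum>j<n. c i * cnj (c j) * \<phi> (inv (g j) \<otimes> g i))"
    by (simp add: s_def)
qed

end

section \<open>Minima of affine functions at extreme points\<close>

lemma minimizers_closed_face:
  fixes K :: "('a \<Rightarrow> complex) set" and h :: "('a \<Rightarrow> complex) \<Rightarrow> real"
  assumes K: "compact K" "closed K" "convex K" "K \<noteq> {}"
    and cont: "continuous_on UNIV h"
    and affine: "\<And>x y u. 0 \<le> u \<Longrightarrow> u \<le> 1 \<Longrightarrow> h ((1 - u) *\<^sub>R x + u *\<^sub>R y) = (1 - u) * h x + u * h y"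
  defines "F \<equiv> {x \<in> K. \<forall>y\<in>K. h x \<le> h y}"
  shows "F face_of K" "closed F" "F \<noteq> {}"
proof -
  obtain m where m: "m \<in> K" "\<And>y. y \<in> K \<Longrightarrow> h m \<le> h y"
    using continuous_attains_inf [of K h] K cont continuous_on_subset by blast
  have F: "F = K \<inter> {x. h x \<le> h m}"
    using m by (auto simp: F_def intro: order_trans)
  show "F \<noteq> {}"
    using m F by blast
  show "closed F"
    unfolding F using K(2) cont by (intro closed_Int closed_Collect_le) auto
  show "F face_of K"
    unfolding face_of_def
  proof (intro conjI ballI impI)
    show "F \<subseteq> K"
      using F by blast
    show "convex F"
    proof (rule convexI)
      fix x y and u v :: real
      assume xy: "x \<in> F" "y \<in> F" and uv: "0 \<le> u" "0 \<le> v" "u + v = 1"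
      have u: "u = 1 - v"
        using uv by simp
      have "h (u *\<^sub>R x + v *\<^sub>R y) = u * h x + v * h y"
        unfolding u using affine uv by simp
      also have "\<dots> \<le> h m"
        by (rule convex_bound_le) (use xy uv F in auto)
      finally show "u *\<^sub>R x + v *\<^sub>R y \<in> F"
        using xy uv F convexD [OF K(3)] by blast
    qed
    fix a b x assume ab: "a \<in> K" "b \<in> K" and x: "x \<in> F" "x \<in> open_segment a b"
    then obtain u where u: "0 < u" "u < 1" "x = (1 - u) *\<^sub>R a + u *\<^sub>R b"
      by (auto simp: in_segment)
    have "h x = (1 - u) * h a + u * h b"
      using u affine by simp
    moreover have "h x \<le> h m" "h m \<le> h a" "h m \<le> h b"
      using x ab m F by auto
    ultimately have "(1 - u) * (h a - h m) + u * (h b - h m) \<le> 0"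
      by (simp add: algebra_simps)
    moreover have "0 \<le> (1 - u) * (h a - h m)" "0 \<le> u * (h b - h m)"
      using u \<open>h m \<le> h a\<close> \<open>h m \<le> h b\<close> by simp_all
    ultimately have "(1 - u) * (h a - h m) = 0" "u * (h b - h m) = 0"
      by linarith+
    then show "a \<in> F" "b \<in> F"
      using u ab F by auto
  qed
qed

text \<open>The minimizers form a closed face, and by compactness and Zorn's lemma there is a minimal nonempty
closed face inside it. On a minimal face every continuous affine function is constant, because its
minimizers would be a smaller face. The real and imaginary parts of the coordinates are such
functions and separate points, so a minimal face is a single point.\<close>

theorem extreme_point_minimizes:
  fixes K :: "('a \<Rightarrow> complex) set" and h :: "('a \<Rightarrow> complex) \<Rightarrow> real"
  assumes K: "compact K" "closed K" "convex K" "K \<noteq> {}"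
    and cont: "continuous_on UNIV h"
    and affine: "\<And>x y u. 0 \<le> u \<Longrightarrow> u \<le> 1 \<Longrightarrow> h ((1 - u) *\<^sub>R x + u *\<^sub>R y) = (1 - u) * h x + u * h y"
  obtains e where "e extreme_point_of K" "\<And>x. x \<in> K \<Longrightarrow> h e \<le> h x"
proof -
  define F0 where "F0 = {x \<in> K. \<forall>y\<in>K. h x \<le> h y}"
  note F0 = minimizers_closed_face [OF K cont affine, folded F0_def]
  define \<F> where "\<F> = {F. F face_of K \<and> closed F \<and> F \<noteq> {} \<and> F \<subseteq> F0}"
  have "\<exists>M\<in>uminus ` \<F>. \<forall>S\<in>uminus ` \<F>. M \<subseteq> S \<longrightarrow> S = M"
  proof (rule subset_Zorn_nonempty)
    show "uminus ` \<F> \<noteq> {}"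
      using F0 by (auto simp: \<F>_def)
    fix \<C> assume "\<C> \<noteq> {}" and chain: "subset.chain (uminus ` \<F>) \<C>"
    define \<D> where "\<D> = uminus ` \<C>"
    have \<D>: "\<D> \<noteq> {}" "\<D> \<subseteq> \<F>" and \<D>_chain: "subset.chain \<F> \<D>"
      using \<open>\<C> \<noteq> {}\<close> chain by (auto simp: \<D>_def subset_chain_def)
    have "K \<inter> \<Inter>\<D> \<noteq> {}"
    proof (rule compact_imp_fip [OF K(1)])
      show "closed T" if "T \<in> \<D>" for T
        using that \<D> by (auto simp: \<F>_def)
      fix \<D>' assume D': "finite \<D>'" "\<D>' \<subseteq> \<D>"
      show "K \<inter> \<Inter>\<D>' \<noteq> {}"
      proof (cases "\<D>' = {}")
        case False
        have "subset.chain \<F> \<D>'"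
          unfolding subset_chain_def
          using D'(2) \<D>_chain [unfolded subset_chain_def] by (meson subset_iff)
        then have "\<Inter>\<D>' \<in> \<D>'"
          using D'(1) False by (intro Inter_in_chain)
        then have "\<Inter>\<D>' \<in> \<F>"
          using D' \<D> by blast
        then show ?thesis
          using face_of_imp_subset by (fastforce simp: \<F>_def)
      qed (use K in simp)
    qed
    moreover have "\<Inter>\<D> face_of K" "closed (\<Inter>\<D>)" "\<Inter>\<D> \<subseteq> F0"
      using \<D> by (auto simp: \<F>_def intro!: face_of_Inter closed_Inter)
    ultimately have "\<Inter>\<D> \<in> \<F>"
      by (auto simp: \<F>_def)
    moreover have "\<Union>\<C> = - \<Inter>\<D>"
      by (auto simp: \<D>_def)
    ultimately show "\<Union>\<C> \<in> uminus ` \<F>"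
      by blast
  qed
  then obtain F where F: "F \<in> \<F>" and min: "\<And>F'. F' \<in> \<F> \<Longrightarrow> F' \<subseteq> F \<Longrightarrow> F' = F"
    by force
  have face: "F face_of K" "closed F" "F \<noteq> {}" "F \<subseteq> F0"
    using F by (auto simp: \<F>_def)
  have F': "compact F" "convex F"
    using compact_Int_closed [OF K(1) face(2)] face_of_imp_subset [OF face(1)]
      face_of_imp_convex [OF face(1)] by (simp_all add: Int_absorb1)
  have const: "f x \<le> f y" if "x \<in> F" "y \<in> F" and f: "continuous_on UNIV f"
      "\<And>x y u. 0 \<le> u \<Longrightarrow> u \<le> 1 \<Longrightarrow> f ((1 - u) *\<^sub>R x + u *\<^sub>R y) = (1 - u) * f x + u * f y"
    for x y and f :: "('a \<Rightarrow> complex) \<Rightarrow> real"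
  proof -
    let ?E = "{x \<in> F. \<forall>y\<in>F. f x \<le> f y}"
    note E = minimizers_closed_face [OF F'(1) face(2) F'(2) face(3) f]
    have "?E \<in> \<F>"
      using face_of_trans [OF E(1) face(1)] E(2,3) face(4) by (auto simp: \<F>_def)
    then have "?E = F"
      by (rule min) blast
    then show ?thesis
      using that by blast
  qed
  have single: "x = y" if "x \<in> F" "y \<in> F" for x y
  proof
    fix i
    have "Re (x i) = Re (y i)"
      by (intro antisym const [where f = "\<lambda>x. Re (x i)"] that)
        (auto intro!: continuous_intros continuous_on_product_coordinates simp: scaleR_fun_def)
    moreover have "Im (x i) = Im (y i)"
      by (intro antisym const [where f = "\<lambda>x. Im (x i)"] that)
        (auto intro!: continuous_intros continuous_on_product_coordinates simp: scaleR_fun_def)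
    ultimately show "x i = y i"
      by (rule complex_eqI)
  qed
  obtain e where "e \<in> F"
    using face(3) by blast
  then have "F = {e}"
    using single by blast
  then have "e extreme_point_of K"
    using face(1) face_of_singleton by blast
  moreover have "h e \<le> h x" if "x \<in> K" for x
    using \<open>e \<in> F\<close> face(4) that by (auto simp: F0_def)
  ultimately show thesis
    by (rule that)
qed

section \<open>The convex set of traces\<close>

lemma closed_traces: "closed (traces G)"
proof -
  have 1: "closed {\<phi>. positive_definite G \<phi>}"
    unfolding positive_definite_def
    by (intro closed_Collect_all closed_Collect_imp open_Collect_const)
      (intro closed_vimage [unfolded vimage_def] continuous_intros continuous_on_product_coordinates closed_nonneg_Reals_complex)
  have 2: "closed {\<phi>. conjugation_invariant G \<phi>}"
    unfolding conjugation_invariant_def Ball_def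
    by (intro closed_Collect_all closed_Collect_imp open_Collect_const closed_Collect_eq
        continuous_on_product_coordinates)
  have 3: "closed {\<phi>. \<phi> \<one>\<^bsub>G\<^esub> = (1 :: complex)}"
    by (intro closed_Collect_eq continuous_on_product_coordinates continuous_on_const)
  have 4: "closed {\<phi>. \<forall>x. x \<notin> carrier G \<longrightarrow> \<phi> x = (0 :: complex)}"
    by (intro closed_Collect_all closed_Collect_imp open_Collect_const closed_Collect_eq
        continuous_on_product_coordinates continuous_on_const)
  show ?thesis
    using closed_Int [OF 1 closed_Int [OF 2 closed_Int [OF 3 4]]]
    by (simp add: traces_def Collect_conj_eq)
qed

text \<open>A closed set of functions with values in the closed unit disc, compact by Tychonoff's theorem.\<close>

lemma compact_traces:
  assumes "group G"
  shows "compact (traces (G :: ('a, 'm) monoid_scheme))"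
proof -
  let ?B = "Pi\<^sub>E UNIV (\<lambda>_. cball 0 1) :: ('a \<Rightarrow> complex) set"
  have "compactin (product_topology (\<lambda>_. euclidean) UNIV) ?B"
    by (subst compactin_PiE) simp
  then have "compact ?B"
    by (simp add: euclidean_product_topology)
  moreover have "traces G \<subseteq> ?B"
  proof
    fix \<phi> assume "\<phi> \<in> traces G"
    then interpret group_trace G \<phi>
      using assms by (simp add: group_trace_def group_trace_axioms_def)
    have "cmod (\<phi> x) \<le> 1" for x
      using cmod_trace_le_one [of x] trace by (cases "x \<in> carrier G") (auto simp: traces_def)
    then show "\<phi> \<in> ?B"
      by (simp add: PiE_iff)
  qed
  ultimately show ?thesis
    using compact_Int_closed [OF _ closed_traces, of ?B G] by (simp add: Int_absorb1)
qed

lemma convex_traces: "convex (traces G)"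
proof (rule convexI)
  fix \<phi> \<psi> and u v :: real
  assume *: "\<phi> \<in> traces G" "\<psi> \<in> traces G" "0 \<le> u" "0 \<le> v" "u + v = 1"
  have "positive_definite G (u *\<^sub>R \<phi> + v *\<^sub>R \<psi>)"
    unfolding positive_definite_def
  proof (intro allI impI)
    fix n g c assume g: "\<forall>i<(n::nat). g i \<in> carrier G"
    let ?S = "\<lambda>\<phi>. \<Sum>i<n. \<Sum>j<n. c i * cnj (c j) * \<phi> (inv\<^bsub>G\<^esub> (g j) \<otimes>\<^bsub>G\<^esub> g i)"
    have "?S (u *\<^sub>R \<phi> + v *\<^sub>R \<psi>) = of_real u * ?S \<phi> + of_real v * ?S \<psi>"
      by (simp add: scaleR_fun_def scaleR_conv_of_real sum_distrib_left sum.distrib algebra_simps)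
    moreover have "?S \<phi> \<in> \<real>\<^sub>\<ge>\<^sub>0" "?S \<psi> \<in> \<real>\<^sub>\<ge>\<^sub>0"
      using * g by (simp_all add: traces_def positive_definite_def)
    ultimately show "?S (u *\<^sub>R \<phi> + v *\<^sub>R \<psi>) \<in> \<real>\<^sub>\<ge>\<^sub>0"
      using * by (simp add: nonneg_Reals_add_I nonneg_Reals_mult_I)
  qed
  then show "u *\<^sub>R \<phi> + v *\<^sub>R \<psi> \<in> traces G"
    using * by (auto simp: traces_def conjugation_invariant_def scaleR_fun_def scaleR_conv_of_real
        simp flip: of_real_add)
qed

lemma sum_sum_cnj: "(\<Sum>i<(n::nat). \<Sum>j<n. c i * cnj (c j)) = of_real ((cmod (\<Sum>i<n. c i))\<^sup>2)"
  by (simp only: complex_norm_square) (simp add: sum_product)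

lemma trivial_character_trace:
  assumes "group G"
  shows "trivial_character G \<in> traces G"
proof -
  interpret group G
    by (rule assms)
  have "(\<Sum>i<n. \<Sum>j<n. c i * cnj (c j) * trivial_character G (inv\<^bsub>G\<^esub> (g j) \<otimes>\<^bsub>G\<^esub> g i)) \<in> \<real>\<^sub>\<ge>\<^sub>0"
    if "\<forall>i<(n::nat). g i \<in> carrier G" for n g c
  proof -
    have "(\<Sum>i<n. \<Sum>j<n. c i * cnj (c j) * trivial_character G (inv\<^bsub>G\<^esub> (g j) \<otimes>\<^bsub>G\<^esub> g i)) =
        (\<Sum>i<n. \<Sum>j<n. c i * cnj (c j))"
      using that by (simp add: trivial_character_def)
    then show ?thesis
      by (simp only: sum_sum_cnj nonneg_Reals_of_real_iff) simp
  qed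
  then show ?thesis
    by (auto simp: traces_def positive_definite_def conjugation_invariant_def trivial_character_def)
qed

section \<open>Property (ET) and traces close to the trivial character\<close>

text \<open>A neighbourhood of the trivial character that contains no other character can be taken to be
determined by finitely many group elements. The distance from 1 at these elements is measured by
\<open>1 - Re (\<psi> x)\<close>, which is nonnegative and, unlike \<open>|1 - \<psi> x|\<close>, affine in \<open>\<psi>\<close>.\<close>

lemma ET_separating_set:
  assumes "group K" "property_ET K"
  obtains F \<epsilon> where "finite F" "F \<subseteq> carrier K" "0 < \<epsilon>"
    "\<And>\<psi>. \<psi> \<in> characters K \<Longrightarrow> \<psi> \<noteq> trivial_character K \<Longrightarrow> \<epsilon> \<le> (\<Sum>x\<in>F. 1 - Re (\<psi> x))"
proof -
  obtain U where U: "open U" "U \<inter> characters K = {trivial_character K}"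
    using assms(2) by (auto simp: property_ET_def isolated_in_def)
  then have "openin (product_topology (\<lambda>_. euclidean) UNIV) U" "trivial_character K \<in> U"
    by (auto simp: euclidean_product_topology)
  from product_topology_open_contains_basis [OF this]
  obtain V where V: "trivial_character K \<in> Pi\<^sub>E UNIV V" "\<And>x. open (V x)" "finite {x. V x \<noteq> UNIV}"
      "Pi\<^sub>E UNIV V \<subseteq> U"
    by auto
  define F where "F = {x \<in> carrier K. V x \<noteq> UNIV}"
  have F: "finite F" "F \<subseteq> carrier K"
    using V(3) by (auto simp: F_def intro: finite_subset)
  have "\<exists>r>0. ball 1 r \<subseteq> V x" if "x \<in> F" for x
  proof -
    have "1 \<in> V x"
      using V(1) that by (auto simp: PiE_def Pi_def F_def trivial_character_def dest: spec [of _ x])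
    then show ?thesis
      using V(2) [of x] openE by blast
  qed
  then obtain r where r: "\<And>x. x \<in> F \<Longrightarrow> 0 < r x \<and> ball 1 (r x) \<subseteq> V x"
    by metis
  define \<delta> where "\<delta> = Min (insert 1 (r ` F))"
  have \<delta>: "0 < \<delta>" "\<And>x. x \<in> F \<Longrightarrow> \<delta> \<le> r x"
    using F(1) r by (auto simp: \<delta>_def)
  show thesis
  proof
    show "finite F" "F \<subseteq> carrier K" "0 < \<delta>\<^sup>2 / 2"
      using F \<delta> by auto
    fix \<psi> assume \<psi>: "\<psi> \<in> characters K" "\<psi> \<noteq> trivial_character K"
    then have "\<psi> \<in> traces K"
      by (simp add: characters_def extreme_point_of_def)
    then interpret group_trace K \<psi>
      using assms(1) by (simp add: group_trace_def group_trace_axioms_def)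
    have "\<psi> \<notin> Pi\<^sub>E UNIV V"
      using \<psi> U V(4) by blast
    then obtain x where x: "\<psi> x \<notin> V x"
      by (auto simp: PiE_def)
    have "x \<in> carrier K"
    proof (rule ccontr)
      assume "x \<notin> carrier K"
      then have "\<psi> x = trivial_character K x"
        using trace by (simp add: traces_def trivial_character_def)
      then show False
        using V(1) x by (auto simp: PiE_def Pi_def)
    qed
    with x have "x \<in> F"
      by (auto simp: F_def)
    then have "\<psi> x \<notin> ball 1 \<delta>"
      using r [of x] subset_ball [OF \<delta>(2) [of x], of 1] x by blast
    then have "\<delta>\<^sup>2 \<le> (cmod (1 - \<psi> x))\<^sup>2"
      using \<delta>(1) by (auto simp: dist_norm intro: power_mono)
    also have "\<dots> = 1 - 2 * Re (\<psi> x) + (cmod (\<psi> x))\<^sup>2"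
      unfolding cmod_power2 by (simp add: power2_eq_square algebra_simps)
    also have "\<dots> \<le> 2 * (1 - Re (\<psi> x))"
      using cmod_trace_le_one [OF \<open>x \<in> carrier K\<close>] by (simp add: power_le_one)
    finally have "\<delta>\<^sup>2 / 2 \<le> 1 - Re (\<psi> x)"
      by simp
    also have "\<dots> \<le> (\<Sum>x\<in>F. 1 - Re (\<psi> x))"
    proof (rule member_le_sum [OF \<open>x \<in> F\<close> _ F(1)])
      fix y assume "y \<in> F - {x}"
      then show "0 \<le> 1 - Re (\<psi> y)"
        using F(2) cmod_trace_le_one [of y] complex_Re_le_cmod [of "\<psi> y"] by fastforce
    qed
    finally show "\<delta>\<^sup>2 / 2 \<le> (\<Sum>x\<in>F. 1 - Re (\<psi> x))" .
  qed
qed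

text \<open>For fixed coefficients, the two sides of the inequality in the definition of the weight are
continuous and affine in \<open>\<psi>\<close>, so their difference is minimal at a character. For the trivial
character both sides are equal; for any other character the weight on the left is not positive.\<close>

lemma traces_weight_bound:
  assumes "group K" and "0 < \<epsilon>" and F: "F \<subseteq> carrier K"
    and sep: "\<And>\<psi>. \<psi> \<in> characters K \<Longrightarrow> \<psi> \<noteq> trivial_character K \<Longrightarrow> \<epsilon> \<le> (\<Sum>x\<in>F. 1 - Re (\<psi> x))"
    and "\<psi> \<in> traces K"
  shows "trivial_weight K (carrier K) (1 - (\<Sum>x\<in>F. 1 - Re (\<psi> x)) / \<epsilon>) \<psi>"
  unfolding trivial_weight_def
proof (intro allI impI)
  interpret group K
    by (rule assms)
  fix n :: nat and g and c :: "nat \<Rightarrow> complex"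
  assume g: "\<forall>i<n. g i \<in> carrier K"
  let ?S = "\<lambda>\<psi>. Re (\<Sum>i<n. \<Sum>j<n. c i * cnj (c j) * \<psi> (inv\<^bsub>K\<^esub> (g j) \<otimes>\<^bsub>K\<^esub> g i))"
  let ?t = "(cmod (\<Sum>i<n. c i))\<^sup>2"
  define h where "h \<psi> = ?S \<psi> - (1 - (\<Sum>x\<in>F. 1 - Re (\<psi> x)) / \<epsilon>) * ?t" for \<psi>
  have cont: "continuous_on UNIV h"
    unfolding h_def by (intro continuous_intros continuous_on_product_coordinates) (use \<open>0 < \<epsilon>\<close> in auto)
  have S_affine: "?S ((1 - u) *\<^sub>R x + u *\<^sub>R y) = (1 - u) * ?S x + u * ?S y" for x y u
  proof -
    have "(\<Sum>i<n. \<Sum>j<n. c i * cnj (c j) * ((1 - u) *\<^sub>R x + u *\<^sub>R y) (inv\<^bsub>K\<^esub> (g j) \<otimes>\<^bsub>K\<^esub> g i)) =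
      (1 - u) *\<^sub>R (\<Sum>i<n. \<Sum>j<n. c i * cnj (c j) * x (inv\<^bsub>K\<^esub> (g j) \<otimes>\<^bsub>K\<^esub> g i)) +
      u *\<^sub>R (\<Sum>i<n. \<Sum>j<n. c i * cnj (c j) * y (inv\<^bsub>K\<^esub> (g j) \<otimes>\<^bsub>K\<^esub> g i))"
      by (simp add: scaleR_fun_def scaleR_sum_right distrib_left mult_scaleR_right sum.distrib)
    then show ?thesis
      by simp
  qed
  have L_affine: "(\<Sum>z\<in>F. 1 - Re (((1 - u) *\<^sub>R x + u *\<^sub>R y) z)) =
      (1 - u) * (\<Sum>z\<in>F. 1 - Re (x z)) + u * (\<Sum>z\<in>F. 1 - Re (y z))" for x y u
    by (simp add: scaleR_fun_def sum_distrib_left sum.distrib [symmetric] algebra_simps)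
  have affine: "h ((1 - u) *\<^sub>R x + u *\<^sub>R y) = (1 - u) * h x + u * h y" for x y u
    unfolding h_def S_affine L_affine by (simp add: add_divide_distrib diff_divide_distrib algebra_simps)
  obtain e where e: "e extreme_point_of traces K" "\<And>x. x \<in> traces K \<Longrightarrow> h e \<le> h x"
    using extreme_point_minimizes [OF compact_traces [OF assms(1)] closed_traces convex_traces _ cont affine]
      \<open>\<psi> \<in> traces K\<close> by blast
  have e_trace: "e \<in> traces K"
    using e(1) by (simp add: extreme_point_of_def)
  have "0 \<le> h e"
  proof (cases "e = trivial_character K")
    case True
    have "(\<Sum>x\<in>F. 1 - Re (e x)) = 0"
      using F by (auto simp: True trivial_character_def intro!: sum.neutral)
    moreover have "(\<Sum>i<n. \<Sum>j<n. c i * cnj (c j) * e (inv\<^bsub>K\<^esub> (g j) \<otimes>\<^bsub>K\<^esub> g i)) = (\<Sum>i<n. \<Sum>j<n. c i * cnj (c j))"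
      using g by (simp add: True trivial_character_def)
    ultimately show ?thesis
      by (simp only: h_def sum_sum_cnj Re_complex_of_real) simp
  next
    case False
    then have "\<epsilon> \<le> (\<Sum>x\<in>F. 1 - Re (e x))"
      using sep e(1) by (simp add: characters_def)
    then have "(1 - (\<Sum>x\<in>F. 1 - Re (e x)) / \<epsilon>) * ?t \<le> 0"
      using \<open>0 < \<epsilon>\<close> by (intro mult_nonpos_nonneg) auto
    moreover have "0 \<le> ?S e"
      using e_trace g by (simp add: traces_def positive_definite_def complex_nonneg_Reals_iff del: Re_sum)
    ultimately show ?thesis
      by (simp add: h_def)
  qed
  also have "h e \<le> h \<psi>"
    by (rule e(2) [OF \<open>\<psi> \<in> traces K\<close>])
  finally show "(1 - (\<Sum>x\<in>F. 1 - Re (\<psi> x)) / \<epsilon>) * ?t \<le> ?S \<psi>"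
    by (simp add: h_def)
qed

text \<open>The weight on \<open>A\<close> tends to 1 as traces approach the trivial character. Filters make the permanence
properties below independent of any choice of neighbourhoods of the
trivial character.\<close>

definition trivializes_near_one :: "('a, 'm) monoid_scheme \<Rightarrow> 'a set \<Rightarrow> bool"
  where "trivializes_near_one G A \<longleftrightarrow> (\<forall>\<eta>>0. \<forall>\<^sub>F \<phi> in nhds (trivial_character G).
    \<phi> \<in> traces G \<longrightarrow> trivial_weight G A (1 - \<eta>) \<phi>)"

lemma trivial_weight_mono:
  assumes "trivial_weight G A \<alpha> \<phi>" "B \<subseteq> A" "\<beta> \<le> \<alpha>"
  shows "trivial_weight G B \<beta> \<phi>"
  unfolding trivial_weight_def
proof (intro allI impI)
  fix n g c assume g: "\<forall>i<(n::nat). g i \<in> B"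
  have "\<beta> * (cmod (\<Sum>i<n. c i))\<^sup>2 \<le> \<alpha> * (cmod (\<Sum>i<n. c i))\<^sup>2"
    using assms(3) by (intro mult_right_mono) auto
  also have "\<dots> \<le> Re (\<Sum>i<n. \<Sum>j<n. c i * cnj (c j) * \<phi> (inv\<^bsub>G\<^esub> (g j) \<otimes>\<^bsub>G\<^esub> g i))"
    using assms(1,2) g unfolding trivial_weight_def by blast
  finally show "\<beta> * (cmod (\<Sum>i<n. c i))\<^sup>2 \<le> \<dots>" .
qed

lemma pullback_trace:
  assumes G: "group G" and K: "group K" and f: "f \<in> hom K G" and \<phi>: "\<phi> \<in> traces G"
  shows "(\<lambda>x. if x \<in> carrier K then \<phi> (f x) else 0) \<in> traces K"
proof -
  interpret G: group G by (rule G)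
  interpret K: group K by (rule K)
  interpret f: group_hom K G f
    using f by unfold_locales
  have "positive_definite K (\<lambda>x. if x \<in> carrier K then \<phi> (f x) else 0)"
    unfolding positive_definite_def
  proof (intro allI impI)
    fix n g c assume g: "\<forall>i<(n::nat). g i \<in> carrier K"
    then have "\<forall>i<n. f (g i) \<in> carrier G"
      by simp
    then have "(\<Sum>i<n. \<Sum>j<n. c i * cnj (c j) * \<phi> (inv\<^bsub>G\<^esub> (f (g j)) \<otimes>\<^bsub>G\<^esub> f (g i))) \<in> \<real>\<^sub>\<ge>\<^sub>0"
      using \<phi> by (simp add: traces_def positive_definite_def)
    then show "(\<Sum>i<n. \<Sum>j<n. c i * cnj (c j) * (if inv\<^bsub>K\<^esub> (g j) \<otimes>\<^bsub>K\<^esub> g i \<in> carrier K then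
        \<phi> (f (inv\<^bsub>K\<^esub> (g j) \<otimes>\<^bsub>K\<^esub> g i)) else 0)) \<in> \<real>\<^sub>\<ge>\<^sub>0"
      using g by simp
  qed
  then show ?thesis
    using \<phi> by (auto simp: traces_def conjugation_invariant_def)
qed

text \<open>Traces of \<open>G\<close> pull back to traces of \<open>K\<close>, and the bound on the weight of the pullback depends
continuously on its values at finitely many elements.\<close>

lemma ET_image_trivializes:
  assumes G: "group G" and K: "group K" and f: "f \<in> hom K G" and "property_ET K"
  shows "trivializes_near_one G (f ` carrier K)"
  unfolding trivializes_near_one_def
proof (intro allI impI)
  fix \<eta> :: real assume "0 < \<eta>"
  interpret G: group G by (rule G)
  interpret K: group K by (rule K)
  interpret f: group_hom K G f
    using f by unfold_locales
  obtain F \<epsilon> where F: "finite F" "F \<subseteq> carrier K" "0 < \<epsilon>"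
    and sep: "\<And>\<psi>. \<psi> \<in> characters K \<Longrightarrow> \<psi> \<noteq> trivial_character K \<Longrightarrow> \<epsilon> \<le> (\<Sum>x\<in>F. 1 - Re (\<psi> x))"
    by (rule ET_separating_set [OF K \<open>property_ET K\<close>]) (rule that)
  let ?U = "{\<phi>. (\<Sum>x\<in>F. 1 - Re (\<phi> (f x))) < \<eta> * \<epsilon>}"
  have "open ?U"
    by (intro open_Collect_less continuous_intros continuous_on_product_coordinates)
  moreover have "(\<Sum>x\<in>F. 1 - Re (trivial_character G (f x))) = 0"
    using F(2) by (intro sum.neutral) (auto simp: trivial_character_def)
  then have "trivial_character G \<in> ?U"
    using \<open>0 < \<eta>\<close> \<open>0 < \<epsilon>\<close> by simp
  moreover have "trivial_weight G (f ` carrier K) (1 - \<eta>) \<phi>" if \<phi>: "\<phi> \<in> ?U" "\<phi> \<in> traces G" for \<phi>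
    unfolding trivial_weight_def
  proof (intro allI impI)
    fix n g c assume "\<forall>i<(n::nat). g i \<in> f ` carrier K"
    then have "\<forall>i\<in>{..<n}. \<exists>k. k \<in> carrier K \<and> g i = f k"
      by blast
    then obtain k where k: "\<And>i. i < n \<Longrightarrow> k i \<in> carrier K" "\<And>i. i < n \<Longrightarrow> g i = f (k i)"
      by (metis lessThan_iff)
    let ?\<psi> = "\<lambda>x. if x \<in> carrier K then \<phi> (f x) else 0"
    have "(\<Sum>x\<in>F. 1 - Re (?\<psi> x)) = (\<Sum>x\<in>F. 1 - Re (\<phi> (f x)))"
      using F(2) by (intro sum.cong) auto
    then have "1 - \<eta> \<le> 1 - (\<Sum>x\<in>F. 1 - Re (?\<psi> x)) / \<epsilon>"
      using \<phi>(1) \<open>0 < \<epsilon>\<close> by (simp add: field_simps)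
    then have "trivial_weight K (carrier K) (1 - \<eta>) ?\<psi>"
      using traces_weight_bound [OF K F(3,2) sep pullback_trace [OF G K f \<phi>(2)]]
        trivial_weight_mono by blast
    then have "(1 - \<eta>) * (cmod (\<Sum>i<n. c i))\<^sup>2 \<le>
        Re (\<Sum>i<n. \<Sum>j<n. c i * cnj (c j) * ?\<psi> (inv\<^bsub>K\<^esub> (k j) \<otimes>\<^bsub>K\<^esub> k i))"
      using k(1) unfolding trivial_weight_def by blast
    also have "(\<Sum>i<n. \<Sum>j<n. c i * cnj (c j) * ?\<psi> (inv\<^bsub>K\<^esub> (k j) \<otimes>\<^bsub>K\<^esub> k i)) =
        (\<Sum>i<n. \<Sum>j<n. c i * cnj (c j) * \<phi> (inv\<^bsub>G\<^esub> (g j) \<otimes>\<^bsub>G\<^esub> g i))"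
      using k by (intro sum.cong refl) simp
    finally show "(1 - \<eta>) * (cmod (\<Sum>i<n. c i))\<^sup>2 \<le>
        Re (\<Sum>i<n. \<Sum>j<n. c i * cnj (c j) * \<phi> (inv\<^bsub>G\<^esub> (g j) \<otimes>\<^bsub>G\<^esub> g i))" .
  qed
  ultimately show "\<forall>\<^sub>F \<phi> in nhds (trivial_character G). \<phi> \<in> traces G \<longrightarrow>
      trivial_weight G (f ` carrier K) (1 - \<eta>) \<phi>"
    unfolding eventually_nhds by blast
qed

lemma trivializes_generate:
  assumes G: "group G" and A: "subgroup A G" "trivializes_near_one G A"
    and B: "subgroup B G" "trivializes_near_one G B"
  shows "trivializes_near_one G (generate G (A \<union> B))"
  unfolding trivializes_near_one_def
proof (intro allI impI)
  fix \<eta> :: real assume "0 < \<eta>"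
  then have "\<forall>\<^sub>F \<phi> in nhds (trivial_character G). \<phi> \<in> traces G \<longrightarrow> trivial_weight G A (1 - \<eta> / 2) \<phi>"
    "\<forall>\<^sub>F \<phi> in nhds (trivial_character G). \<phi> \<in> traces G \<longrightarrow> trivial_weight G B (1 - \<eta> / 2) \<phi>"
    using A(2) B(2) by (simp_all add: trivializes_near_one_def)
  then show "\<forall>\<^sub>F \<phi> in nhds (trivial_character G). \<phi> \<in> traces G \<longrightarrow>
      trivial_weight G (generate G (A \<union> B)) (1 - \<eta>) \<phi>"
  proof eventually_elim
    case (elim \<phi>)
    show ?case
    proof
      assume "\<phi> \<in> traces G"
      then interpret group_trace G \<phi>
        using G by (simp add: group_trace_def group_trace_axioms_def)
      show "trivial_weight G (generate G (A \<union> B)) (1 - \<eta>) \<phi>"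
        using trivial_weight_generate [OF A(1) B(1)] elim \<open>\<phi> \<in> traces G\<close> by fastforce
    qed
  qed
qed

lemma trivializes_generate_UN:
  assumes "group G" "finite I"
    and A: "\<And>i. i \<in> I \<Longrightarrow> subgroup (A i) G" "\<And>i. i \<in> I \<Longrightarrow> trivializes_near_one G (A i)"
  shows "trivializes_near_one G (generate G (\<Union>i\<in>I. A i))"
proof -
  interpret group G
    by (rule assms)
  show ?thesis
    using assms(2) A
  proof (induction I)
    case empty
    have "trivial_weight G {\<one>\<^bsub>G\<^esub>} (1 - \<eta>) \<phi>" if "0 < \<eta>" "\<phi> \<in> traces G" for \<eta> \<phi>
      unfolding trivial_weight_def
    proof (intro allI impI)
      fix n g c assume g: "\<forall>i<(n::nat). g i \<in> {\<one>\<^bsub>G\<^esub>}"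
      have "\<phi> \<one>\<^bsub>G\<^esub> = 1"
        using that by (simp add: traces_def)
      then have "(\<Sum>i<n. \<Sum>j<n. c i * cnj (c j) * \<phi> (inv\<^bsub>G\<^esub> (g j) \<otimes>\<^bsub>G\<^esub> g i)) = (\<Sum>i<n. \<Sum>j<n. c i * cnj (c j))"
        using g by simp
      then show "(1 - \<eta>) * (cmod (\<Sum>i<n. c i))\<^sup>2 \<le>
          Re (\<Sum>i<n. \<Sum>j<n. c i * cnj (c j) * \<phi> (inv\<^bsub>G\<^esub> (g j) \<otimes>\<^bsub>G\<^esub> g i))"
        using that by (simp only: sum_sum_cnj Re_complex_of_real) (simp add: mult_left_le_one_le left_diff_distrib)
    qed
    then show ?case
      by (simp add: trivializes_near_one_def generate_empty)
  next
    case (insert i I)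
    let ?H = "generate G (\<Union>i\<in>I. A i)"
    have sub: "(\<Union>i\<in>I. A i) \<subseteq> carrier G"
      using insert.prems(1) subgroup.subset by blast
    have "trivializes_near_one G (generate G (?H \<union> A i))"
      using insert by (intro trivializes_generate generate_is_subgroup sub \<open>group G\<close>) auto
    moreover have "generate G (\<Union>i\<in>insert i I. A i) \<subseteq> generate G (?H \<union> A i)"
      by (intro mono_generate) (auto intro: generate.incl)
    ultimately show ?case
      unfolding trivializes_near_one_def
      by (auto elim!: eventually_mono all_forward imp_forward intro: trivial_weight_mono)
  qed
qed

text \<open>Weight \<open>1/2\<close> means that \<open>\<psi> = 2 \<phi> - 1\<close> is again a trace, and \<open>\<phi>\<close> is the midpoint of \<open>1\<close> and \<open>\<psi>\<close>.\<close>

lemma character_with_trivial_weight: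
  assumes G: "group G" and \<phi>: "\<phi> \<in> characters G" and weight: "trivial_weight G (carrier G) (1/2) \<phi>"
  shows "\<phi> = trivial_character G"
proof (rule ccontr)
  assume ne: "\<phi> \<noteq> trivial_character G"
  interpret group G
    by (rule G)
  have trace: "\<phi> \<in> traces G"
    using \<phi> by (simp add: characters_def extreme_point_of_def)
  define \<psi> where "\<psi> = 2 *\<^sub>R \<phi> - trivial_character G"
  have "positive_definite G \<psi>"
    unfolding positive_definite_def
  proof (intro allI impI)
    fix n g c assume g: "\<forall>i<(n::nat). g i \<in> carrier G"
    let ?S = "\<lambda>\<phi>. \<Sum>i<n. \<Sum>j<n. c i * cnj (c j) * \<phi> (inv\<^bsub>G\<^esub> (g j) \<otimes>\<^bsub>G\<^esub> g i)"
    have "?S \<psi> = 2 * ?S \<phi> - ?S (trivial_character G)"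
      by (simp add: \<psi>_def scaleR_fun_def scaleR_conv_of_real sum_distrib_left sum_subtractf algebra_simps)
    also have "?S (trivial_character G) = (\<Sum>i<n. \<Sum>j<n. c i * cnj (c j))"
      using g by (simp add: trivial_character_def)
    finally have "?S \<psi> = 2 * ?S \<phi> - of_real ((cmod (\<Sum>i<n. c i))\<^sup>2)"
      by (simp only: sum_sum_cnj)
    moreover have "?S \<phi> \<in> \<real>\<^sub>\<ge>\<^sub>0"
      using trace g by (simp add: traces_def positive_definite_def)
    moreover have "1/2 * (cmod (\<Sum>i<n. c i))\<^sup>2 \<le> Re (?S \<phi>)"
      using weight g by (simp only: trivial_weight_def)
    ultimately show "?S \<psi> \<in> \<real>\<^sub>\<ge>\<^sub>0"
      by (simp add: complex_nonneg_Reals_iff del: Re_sum Im_sum)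
  qed
  then have "\<psi> \<in> traces G"
    using trace by (auto simp: traces_def conjugation_invariant_def \<psi>_def scaleR_fun_def trivial_character_def
        scaleR_conv_of_real)
  moreover have "\<phi> \<in> open_segment (trivial_character G) \<psi>"
    unfolding in_segment
  proof (intro conjI exI [of _ "1/2"])
    show "\<phi> = (1 - 1/2) *\<^sub>R trivial_character G + (1/2) *\<^sub>R \<psi>"
      by (simp add: \<psi>_def scaleR_diff_right)
    show "trivial_character G \<noteq> \<psi>"
    proof
      assume "trivial_character G = \<psi>"
      then have "2 *\<^sub>R \<phi> = 2 *\<^sub>R trivial_character G"
        by (simp add: \<psi>_def scaleR_2)
      then show False
        using ne by simp
    qed
  qed simp_all
  ultimately show False
    using \<phi> trivial_character_trace [OF G] by (simp add: characters_def extreme_point_of_def)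
qed

text \<open>Traces on the segment from the trivial character to another trace come arbitrarily close to the
trivial character without being equal to it, whereas characters do not.\<close>

theorem not_poulsen_if_trivializes:
  assumes G: "group G" and triv: "trivializes_near_one G (carrier G)"
  shows "\<not> poulsen_simplex (traces G)"
proof
  assume P: "poulsen_simplex (traces G)"
  let ?one = "trivial_character G"
  have one: "?one \<in> traces G"
    by (rule trivial_character_trace [OF G])
  have "\<forall>\<^sub>F \<phi> in nhds ?one. \<phi> \<in> traces G \<longrightarrow> trivial_weight G (carrier G) (1/2) \<phi>"
    using triv [unfolded trivializes_near_one_def, rule_format, of "1/2"] by simp
  then obtain U where U: "open U" "?one \<in> U"
      "\<And>\<phi>. \<phi> \<in> U \<Longrightarrow> \<phi> \<in> traces G \<Longrightarrow> trivial_weight G (carrier G) (1/2) \<phi>"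
    unfolding eventually_nhds by blast
  obtain \<psi> where \<psi>: "\<psi> \<in> traces G" "\<psi> \<noteq> ?one"
    using P one unfolding poulsen_simplex_def is_singleton_def by blast
  then obtain x where x: "\<psi> x \<noteq> ?one x"
    by blast
  define \<gamma> where "\<gamma> t = (1 - t) *\<^sub>R ?one + t *\<^sub>R \<psi>" for t :: real
  have "continuous_on UNIV \<gamma>"
    unfolding \<gamma>_def
    by (rule continuous_on_coordinatewise_then_product)
      (auto simp: scaleR_fun_def intro!: continuous_intros)
  then have "open (\<gamma> -` U)"
    using U(1) by (simp add: open_vimage)
  moreover have "0 \<in> \<gamma> -` U"
    using U(2) by (simp add: \<gamma>_def)
  ultimately obtain r where r: "0 < r" "ball 0 r \<subseteq> \<gamma> -` U"
    using openE by blast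
  define t where "t = min (1/2) (r/2)"
  have t: "0 < t" "t < 1" "\<gamma> t \<in> U"
    using r by (auto simp: t_def subset_iff dist_norm)
  have "\<gamma> t \<in> traces G"
    unfolding \<gamma>_def using convexD [OF convex_traces one \<psi>(1)] t by simp
  then have closure: "\<gamma> t \<in> closure (characters G)"
    using P by (auto simp: poulsen_simplex_def characters_def)
  let ?V = "U \<inter> {\<phi>. \<phi> x \<noteq> ?one x}"
  have "open {\<phi>. \<phi> x \<noteq> ?one x}"
    by (intro open_Collect_neq continuous_on_product_coordinates continuous_on_const)
  then have "open ?V"
    using U(1) by blast
  moreover have "\<gamma> t x - ?one x = t *\<^sub>R (\<psi> x - ?one x)"
    by (simp add: \<gamma>_def scaleR_fun_def algebra_simps)
  then have "\<gamma> t x \<noteq> ?one x"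
    using t(1) x by auto
  then have "\<gamma> t \<in> ?V"
    using t(3) by simp
  ultimately obtain \<phi> where "\<phi> \<in> ?V" "\<phi> \<in> characters G"
    using closure open_Int_closure_eq_empty [of ?V "characters G"] by blast
  moreover have "\<phi> = ?one"
    using character_with_trivial_weight [OF G] U(3) calculation
    by (auto simp: characters_def extreme_point_of_def)
  ultimately show False
    by simp
qed

theorem not_poulsen_if_generated_by_ET:
  assumes "group G" "finite I"
    and A: "\<And>i. i \<in> I \<Longrightarrow> subgroup (A i) G" "\<And>i. i \<in> I \<Longrightarrow> trivializes_near_one G (A i)"
    and "carrier G \<subseteq> generate G (\<Union>i\<in>I. A i)"
  shows "\<not> poulsen_simplex (traces G)"
proof -
  have "trivializes_near_one G (generate G (\<Union>i\<in>I. A i))"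
    by (rule trivializes_generate_UN) (use assms in auto)
  then have "trivializes_near_one G (carrier G)"
    using assms(5) unfolding trivializes_near_one_def
    by (auto elim!: eventually_mono all_forward imp_forward intro: trivial_weight_mono)
  then show ?thesis
    using not_poulsen_if_trivializes assms(1) by blast
qed

section \<open>Free products and amalgamated products\<close>

lemma fp_words_simps [simp]:
  "[] \<in> fp_words I Gs"
  "(p # w) \<in> fp_words I Gs \<longleftrightarrow> fst p \<in> I \<and> snd p \<in> carrier (Gs (fst p)) \<and> w \<in> fp_words I Gs"
  "(v @ w) \<in> fp_words I Gs \<longleftrightarrow> v \<in> fp_words I Gs \<and> w \<in> fp_words I Gs"
  by (simp add: fp_words_def, cases p, auto simp: fp_words_def)

locale group_family =
  fixes I :: "'i set" and Gs :: "'i \<Rightarrow> 'a monoid"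
  assumes groups: "\<And>i. i \<in> I \<Longrightarrow> group (Gs i)"
begin

abbreviation "W \<equiv> fp_words I Gs"
abbreviation "R \<equiv> fp_rel I Gs"
abbreviation "cls w \<equiv> R `` {w}"

lemma fp_rel_words: "(v, w) \<in> R \<Longrightarrow> v \<in> W \<and> w \<in> W"
proof (induction rule: fp_rel.induct)
  case (fp_one u v i)
  interpret group "Gs i"
    using fp_one groups by blast
  show ?case
    using fp_one by simp
next
  case (fp_mult u v i x y)
  interpret group "Gs i"
    using fp_mult groups by blast
  show ?case
    using fp_mult by simp
qed auto

lemma equiv_fp_rel: "equiv W R"
proof (rule equivI)
  show "R \<subseteq> W \<times> W"
    using fp_rel_words by auto
  show "refl_on W R"
    by (auto simp: refl_on_def intro: fp_rel.fp_refl)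
  show "sym R"
    by (auto simp: sym_def intro: fp_rel.fp_sym)
  show "trans R"
    by (auto simp: trans_def intro: fp_rel.fp_trans)
qed

lemma fp_rel_context:
  assumes "(v, w) \<in> R" "a \<in> W" "b \<in> W"
  shows "(a @ v @ b, a @ w @ b) \<in> R"
  using assms
proof (induction rule: fp_rel.induct)
  case (fp_refl w)
  then show ?case
    by (intro fp_rel.fp_refl) simp
next
  case (fp_sym v w)
  then show ?case
    using fp_rel.fp_sym by blast
next
  case (fp_trans u v w)
  then show ?case
    using fp_rel.fp_trans by blast
next
  case (fp_one u v i)
  then show ?case
    using fp_rel.fp_one [of "a @ u" I Gs "v @ b" i] by simp
next
  case (fp_mult u v i x y)
  then show ?case
    using fp_rel.fp_mult [of "a @ u" I Gs "v @ b" i x y] by simp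
qed

lemma fp_rel_append:
  assumes "(v, v') \<in> R" "(w, w') \<in> R"
  shows "(v @ w, v' @ w') \<in> R"
proof -
  have "(v @ w, v' @ w) \<in> R"
    using fp_rel_context [OF assms(1), of "[]" w] fp_rel_words [OF assms(2)] by simp
  moreover have "(v' @ w, v' @ w') \<in> R"
    using fp_rel_context [OF assms(2), of v' "[]"] fp_rel_words [OF assms(1)] by simp
  ultimately show ?thesis
    by (rule fp_rel.fp_trans)
qed

lemma cls_eq: "(v, w) \<in> R \<Longrightarrow> cls v = cls w"
  using equiv_class_eq [OF equiv_fp_rel] .

lemma carrier_free_product: "A \<in> carrier (free_product I Gs) \<longleftrightarrow> (\<exists>w\<in>W. A = cls w)"
  by (auto simp: free_product_def quotient_def)

lemma one_free_product: "\<one>\<^bsub>free_product I Gs\<^esub> = cls []"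
  by (simp add: free_product_def)

lemma mult_free_product:
  assumes "v \<in> W" "w \<in> W"
  shows "cls v \<otimes>\<^bsub>free_product I Gs\<^esub> cls w = cls (v @ w)"
proof -
  have eq: "cls (a @ b) = cls (v @ w)" if "a \<in> cls v" "b \<in> cls w" for a b
    using cls_eq [OF fp_rel_append [of v a w b]] that by simp
  have "cls v \<noteq> {}" "cls w \<noteq> {}"
    using fp_rel.fp_refl assms by fast+
  then have "(\<Union>a\<in>cls v. \<Union>b\<in>cls w. cls (v @ w)) = cls (v @ w)"
    by simp
  moreover have "(\<Union>a\<in>cls v. \<Union>b\<in>cls w. cls (a @ b)) = (\<Union>a\<in>cls v. \<Union>b\<in>cls w. cls (v @ w))"
    by (intro SUP_cong refl eq)
  ultimately show ?thesis
    by (simp only: free_product_def monoid.simps)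
qed

text \<open>The reversed word of inverses.\<close>

lemma left_inverse_word:
  assumes "w \<in> W"
  shows "\<exists>v\<in>W. (v @ w, []) \<in> R"
  using assms
proof (induction w)
  case Nil
  then show ?case
    by (auto intro!: bexI [of _ "[]"] fp_rel.fp_refl)
next
  case (Cons p w)
  obtain i x where p: "p = (i, x)"
    by fastforce
  then have ix: "i \<in> I" "x \<in> carrier (Gs i)" and w: "w \<in> W"
    using Cons.prems by auto
  interpret group "Gs i"
    using ix groups by blast
  obtain v where v: "v \<in> W" "(v @ w, []) \<in> R"
    using Cons w by blast
  have "(v @ [(i, inv\<^bsub>Gs i\<^esub> x), (i, x)] @ w, v @ [(i, \<one>\<^bsub>Gs i\<^esub>)] @ w) \<in> R"
    using fp_rel.fp_mult [OF v(1) w ix(1), of "inv\<^bsub>Gs i\<^esub> x" x] ix by simp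
  moreover have "(v @ [(i, \<one>\<^bsub>Gs i\<^esub>)] @ w, v @ w) \<in> R"
    by (rule fp_rel.fp_one [OF v(1) w ix(1)])
  ultimately have "(v @ [(i, inv\<^bsub>Gs i\<^esub> x), (i, x)] @ w, []) \<in> R"
    using v(2) fp_rel.fp_trans by blast
  then show ?case
    using v(1) ix by (intro bexI [of _ "v @ [(i, inv\<^bsub>Gs i\<^esub> x)]"]) (simp_all add: p)
qed

lemma group_free_product: "group (free_product I Gs)"
proof (rule groupI)
  show "\<one>\<^bsub>free_product I Gs\<^esub> \<in> carrier (free_product I Gs)"
    by (auto simp: carrier_free_product one_free_product intro!: bexI [of _ "[]"])
next
  fix A assume "A \<in> carrier (free_product I Gs)"
  then obtain w where w: "w \<in> W" "A = cls w"
    by (auto simp: carrier_free_product)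
  then show "\<one>\<^bsub>free_product I Gs\<^esub> \<otimes>\<^bsub>free_product I Gs\<^esub> A = A"
    by (simp add: one_free_product mult_free_product)
  obtain v where v: "v \<in> W" "(v @ w, []) \<in> R"
    using left_inverse_word [OF w(1)] by blast
  then have "cls v \<otimes>\<^bsub>free_product I Gs\<^esub> A = \<one>\<^bsub>free_product I Gs\<^esub>"
    using w cls_eq [OF v(2)] by (simp add: mult_free_product one_free_product)
  then show "\<exists>B\<in>carrier (free_product I Gs). B \<otimes>\<^bsub>free_product I Gs\<^esub> A = \<one>\<^bsub>free_product I Gs\<^esub>"
    using v(1) carrier_free_product by blast
next
  fix A B assume "A \<in> carrier (free_product I Gs)" "B \<in> carrier (free_product I Gs)"
  then obtain v w where vw: "v \<in> W" "A = cls v" "w \<in> W" "B = cls w"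
    by (auto simp: carrier_free_product)
  then show "A \<otimes>\<^bsub>free_product I Gs\<^esub> B \<in> carrier (free_product I Gs)"
    by (auto simp: mult_free_product carrier_free_product intro!: bexI [of _ "v @ w"])
  fix C assume "C \<in> carrier (free_product I Gs)"
  then obtain u where "u \<in> W" "C = cls u"
    by (auto simp: carrier_free_product)
  then show "A \<otimes>\<^bsub>free_product I Gs\<^esub> B \<otimes>\<^bsub>free_product I Gs\<^esub> C =
      A \<otimes>\<^bsub>free_product I Gs\<^esub> (B \<otimes>\<^bsub>free_product I Gs\<^esub> C)"
    using vw by (simp add: mult_free_product)
qed

lemma fp_incl_hom:
  assumes "i \<in> I"
  shows "fp_incl I Gs i \<in> hom (Gs i) (free_product I Gs)"
proof (rule homI)
  fix x y assume xy: "x \<in> carrier (Gs i)" "y \<in> carrier (Gs i)"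
  then show "fp_incl I Gs i x \<in> carrier (free_product I Gs)"
    using assms by (auto simp: fp_incl_def carrier_free_product intro!: bexI [of _ "[(i, x)]"])
  have "([] @ [(i, x), (i, y)] @ [], [] @ [(i, x \<otimes>\<^bsub>Gs i\<^esub> y)] @ []) \<in> R"
    by (rule fp_rel.fp_mult) (use xy assms in simp_all)
  then have "cls [(i, x), (i, y)] = cls [(i, x \<otimes>\<^bsub>Gs i\<^esub> y)]"
    using cls_eq by simp
  then show "fp_incl I Gs i (x \<otimes>\<^bsub>Gs i\<^esub> y) =
      fp_incl I Gs i x \<otimes>\<^bsub>free_product I Gs\<^esub> fp_incl I Gs i y"
    using xy assms by (simp add: fp_incl_def mult_free_product)
qed

lemma generate_free_product:
  "carrier (free_product I Gs) \<subseteq> generate (free_product I Gs) (\<Union>i\<in>I. fp_incl I Gs i ` carrier (Gs i))"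
proof
  fix A assume "A \<in> carrier (free_product I Gs)"
  then obtain w where "w \<in> W" "A = cls w"
    by (auto simp: carrier_free_product)
  then show "A \<in> generate (free_product I Gs) (\<Union>i\<in>I. fp_incl I Gs i ` carrier (Gs i))"
  proof (induction w arbitrary: A)
    case Nil
    then show ?case
      using generate.one [of "free_product I Gs"] by (simp add: one_free_product)
  next
    case (Cons p w)
    obtain i x where p: "p = (i, x)"
      by fastforce
    then have "A = fp_incl I Gs i x \<otimes>\<^bsub>free_product I Gs\<^esub> cls w"
      using Cons.prems by (simp add: fp_incl_def mult_free_product)
    moreover have "fp_incl I Gs i x \<in> (\<Union>i\<in>I. fp_incl I Gs i ` carrier (Gs i))"
      using Cons.prems p by auto
    ultimately show ?case
      using Cons by (auto intro: generate.eng generate.incl)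
  qed
qed

end

lemma (in group) normal_closure_normal:
  assumes "S \<subseteq> carrier G"
  shows "normal_closure G S \<lhd> G"
proof -
  have carrier: "carrier G \<lhd> G"
    by (simp add: normal_inv_iff subgroup_self)
  then have "subgroup (normal_closure G S) G"
    unfolding normal_closure_def
    using assms by (intro subgroups_Inter) (auto simp: normal_imp_subgroup)
  then show ?thesis
    unfolding normal_inv_iff by (auto simp: normal_closure_def normal_inv_iff)
qed

theorem free_product_not_poulsen:
  assumes "finite I" and "\<And>i. i \<in> I \<Longrightarrow> group (Gs i)" and "\<And>i. i \<in> I \<Longrightarrow> property_ET (Gs i)"
  shows "\<not> poulsen_simplex (traces (free_product I Gs))"
proof -
  interpret group_family I Gs
    using assms(2) by (simp add: group_family_def)
  let ?A = "\<lambda>i. fp_incl I Gs i ` carrier (Gs i)"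
  have "subgroup (?A i) (free_product I Gs)" if "i \<in> I" for i
    using group_hom.img_is_subgroup [OF group_hom.intro [OF assms(2) group_free_product
          group_hom_axioms.intro [OF fp_incl_hom]]] that by blast
  then show ?thesis
    using assms generate_free_product
    by (intro not_poulsen_if_generated_by_ET [where A = ?A] group_free_product
        ET_image_trivializes fp_incl_hom) auto
qed

text \<open>A quotient of the free product of the two factors is generated by the images of the factors, which
are homomorphic images of groups with property (ET).\<close>

theorem amalgamated_product_not_poulsen:
  assumes G1: "group G1" "property_ET G1" and G2: "group G2" "property_ET G2"
    and f: "\<And>h. h \<in> carrier H \<Longrightarrow> f1 h \<in> carrier G1" "\<And>h. h \<in> carrier H \<Longrightarrow> f2 h \<in> carrier G2"
  shows "\<not> poulsen_simplex (traces (amalgamated_product H f1 f2 G1 G2))"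
proof -
  interpret G1: group G1 by (rule G1)
  interpret G2: group G2 by (rule G2)
  have T1: "two_factors G1 G2 1 = image_group Inl G1" and T2: "two_factors G1 G2 2 = image_group Inr G2"
    by (simp_all add: two_factors_def)
  have iso1: "Inl \<in> iso G1 (two_factors G1 G2 1)" and iso2: "Inr \<in> iso G2 (two_factors G1 G2 2)"
    unfolding T1 T2 by (simp_all add: inj_imp_image_group_iso)
  interpret group_family "{1, 2}" "two_factors G1 G2"
  proof (rule group_family.intro)
    show "group (two_factors G1 G2 i)" if "i \<in> {1, 2}" for i
      using that T1 T2 G1.inj_imp_image_group_is_group [of Inl] G2.inj_imp_image_group_is_group [of Inr]
      by auto
  qed
  define P where "P = free_product {1, 2} (two_factors G1 G2)"
  define j1 where "j1 x = fp_incl {1, 2} (two_factors G1 G2) 1 (Inl x)" for x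
  define j2 where "j2 x = fp_incl {1, 2} (two_factors G1 G2) 2 (Inr x)" for x
  interpret P: group P
    unfolding P_def by (rule group_free_product)
  have j1: "j1 \<in> hom G1 P"
    using hom_compose [OF iso_imp_homomorphism [OF iso1] fp_incl_hom [of 1]]
    by (simp add: P_def j1_def [abs_def] o_def)
  have j2: "j2 \<in> hom G2 P"
    using hom_compose [OF iso_imp_homomorphism [OF iso2] fp_incl_hom [of 2]]
    by (simp add: P_def j2_def [abs_def] o_def)
  define N where "N = normal_closure P {j1 (f1 h) \<otimes>\<^bsub>P\<^esub> inv\<^bsub>P\<^esub> (j2 (f2 h)) | h. h \<in> carrier H}"
  have "N \<lhd> P"
    unfolding N_def using f hom_in_carrier [OF j1] hom_in_carrier [OF j2]
    by (intro P.normal_closure_normal) auto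
  then interpret N: normal N P .
  let ?Q = "P Mod N"
  define \<pi> where "\<pi> = (\<lambda>x. N #>\<^bsub>P\<^esub> x)"
  have Q: "group ?Q"
    by (rule N.factorgroup_is_group)
  have \<pi>: "\<pi> \<in> hom P ?Q"
    unfolding \<pi>_def by (rule N.r_coset_hom_Mod)
  interpret \<pi>: group_hom P ?Q \<pi>
    using \<pi> Q by (simp add: group_hom_def group_hom_axioms_def P.is_group)
  have h1: "\<pi> \<circ> j1 \<in> hom G1 ?Q" and h2: "\<pi> \<circ> j2 \<in> hom G2 ?Q"
    using hom_compose [OF j1 \<pi>] hom_compose [OF j2 \<pi>] by simp_all
  let ?A = "\<lambda>i::nat. if i = 1 then (\<pi> \<circ> j1) ` carrier G1 else (\<pi> \<circ> j2) ` carrier G2"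
  have sub: "subgroup (?A i) ?Q" for i
    using group_hom.img_is_subgroup [OF group_hom.intro [OF G1(1) Q group_hom_axioms.intro [OF h1]]]
      group_hom.img_is_subgroup [OF group_hom.intro [OF G2(1) Q group_hom_axioms.intro [OF h2]]]
    by simp
  have triv: "trivializes_near_one ?Q (?A i)" for i
    using ET_image_trivializes [OF Q G1(1) h1 G1(2)] ET_image_trivializes [OF Q G2(1) h2 G2(2)] by simp
  have gen: "carrier ?Q \<subseteq> generate ?Q (\<Union>i\<in>{1, 2}. ?A i)"
  proof -
    let ?B = "j1 ` carrier G1 \<union> j2 ` carrier G2"
    have "(\<Union>i\<in>{1, 2}. fp_incl {1, 2} (two_factors G1 G2) i ` carrier (two_factors G1 G2 i)) = ?B"
      by (auto simp: two_factors_def image_group_carrier j1_def j2_def)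
    then have "carrier P \<subseteq> generate P ?B"
      using generate_free_product by (simp add: P_def)
    moreover have "?B \<subseteq> carrier P"
      using hom_in_carrier [OF j1] hom_in_carrier [OF j2] by auto
    ultimately have "\<pi> ` carrier P \<subseteq> generate ?Q (\<pi> ` ?B)"
      using \<pi>.generate_img by blast
    moreover have "carrier ?Q = \<pi> ` carrier P"
      by (auto simp: \<pi>_def FactGroup_def RCOSETS_def)
    moreover have "\<pi> ` ?B = (\<Union>i\<in>{1, 2}. ?A i)"
      by auto
    ultimately show ?thesis
      by simp
  qed
  have "\<not> poulsen_simplex (traces ?Q)"
    by (rule not_poulsen_if_generated_by_ET [OF Q _ sub triv gen]) simp
  then show ?thesis
    by (simp add: amalgamated_product_def Let_def N_def P_def j1_def j2_def)
qed

theorem theorem7p8: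
  fixes m :: nat and Gs :: "nat \<Rightarrow> 'a monoid"
    and G1 :: "'b monoid" and G2 :: "'c monoid" and H :: "'h monoid"
    and f1 :: "'h \<Rightarrow> 'b" and f2 :: "'h \<Rightarrow> 'c"
  shows "(1 \<le> m \<and> (\<forall>i\<in>{1..m}. group (Gs i) \<and> property_ET (Gs i)) \<longrightarrow>
            \<not> poulsen_simplex (traces (free_product {1..m} Gs)))
       \<and> (group G1 \<and> property_ET G1 \<and> group G2 \<and> property_ET G2 \<and>
          group H \<and> f1 \<in> hom H G1 \<and> f2 \<in> hom H G2 \<longrightarrow>
            \<not> poulsen_simplex (traces (amalgamated_product H f1 f2 G1 G2)))"
proof (intro conjI impI)
  assume "1 \<le> m \<and> (\<forall>i\<in>{1..m}. group (Gs i) \<and> property_ET (Gs i))"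
  then show "\<not> poulsen_simplex (traces (free_product {1..m} Gs))"
    by (intro free_product_not_poulsen) auto
next
  assume "group G1 \<and> property_ET G1 \<and> group G2 \<and> property_ET G2 \<and>
      group H \<and> f1 \<in> hom H G1 \<and> f2 \<in> hom H G2"
  then show "\<not> poulsen_simplex (traces (amalgamated_product H f1 f2 G1 G2))"
    by (intro amalgamated_product_not_poulsen) (auto dest: hom_in_carrier)
qed

end
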